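(* For each integer $N\ge2$ let $\omega_N\subset\mathbb{S}^2$ be a zonal equal area configuration of $N$ points, i.e. the set of centers of the cells of the zonal equal area partition of $\mathbb{S}^2$ into $N$ cells (with any choice of the starting angles of the collars). Then the sequence $\{\omega_N\}_{N\ge2}$ is equidistributed and quasi-uniform.
   Context: $\mathbb{S}^2=\{x\in\mathbb{R}^3:|x|=1\}$, $|\cdot|$ is the Euclidean norm, $\sigma$ is the normalized surface area measure ($\sigma(\mathbb{S}^2)=1$). Spherical coordinates $(\phi,\theta)$ denote the point $(\sin\phi\cos\theta,\sin\phi\sin\theta,\cos\phi)$ ($\phi$ the polar angle, $\theta$ the azimuth). Write $$R([\tau_\phi,\nu_\phi]\times[\tau_\theta,\nu_\theta])=\{(\phi,\theta)\in\mathbb{S}^2:\tau_\phi\le\phi\le\nu_\phi,\ \tau_\theta\le\theta\le\nu_\theta\},$$ and $\mathrm{round}(x)$ for the nearest integer to $x$. Zonal equal area partition for a given $N\ge2$: 1. $\phi_c=\cos^{-1}(1-2/N)$. 2. $\delta_I=\sqrt{4\pi/N}$ and $n_I=(\pi-2\phi_c)/\delta_I$. 3. $n=0$ if $N=2$; otherwise $n=\max\{1,\mathrm{round}(n_I)\}$. 4. (If $n\ge1$.) $\delta_F=(\pi-2\phi_c)/n$. For $j=2,\dots,n+1$ let $A_j=2\pi\bigl(\cos(\phi_c+(j-2)\delta_F)-\cos(\phi_c+(j-1)\delta_F)\bigr)$ and let $y_{j,I}=\frac{N A_j}{4\pi}$ be the ideal number of cells in collar $j$; also $y_{1,I}=1$.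 5. Set $a_1=0$, $y_1=1$, and for $j=2,\dots,n+1$ set $y_j=\mathrm{round}(y_{j,I}+a_{j-1})$ and $a_j=\sum_{k=1}^{j}(y_{k,I}-y_k)$. 6. $\phi_0=0$, $\phi_{n+2}=\pi$, and $\phi_j=\cos^{-1}\bigl(1-\frac2N\sum_{k=1}^{j}y_k\bigr)$ for $j=1,\dots,n+1$. The collars are $C_j=R([\phi_{j-1},\phi_j]\times[0,2\pi])$, $j=1,\dots,n+2$; $C_1$ and $C_{n+2}$ are the north and south polar caps. 7. The polar caps $C_1$ and $C_{n+2}$ are each one cell. For $j=2,\dots,n+1$, the collar $C_j$ is divided into the $y_j$ cells $$R\Bigl([\phi_{j-1},\phi_j]\times\bigl[\theta_j+k\tfrac{2\pi}{y_j},\ \theta_j+(k+1)\tfrac{2\pi}{y_j}\bigr]\Bigr),\quad k=0,\dots,y_j-1,$$ where azimuths are taken modulo $2\pi$ and $\theta_j\in[0,2\pi)$ is an arbitrary starting angle (which may depend on $N$). Each cell has $\sigma$-measure $1/N$. The center of a polar cap is the corresponding pole; the center of a cell $R([\tau_\phi,\nu_\phi]\times[\tau_\theta,\nu_\theta])$ in a non-polar collar is the point with spherical coordinates $\bigl(\frac{\tau_\phi+\nu_\phi}2,\frac{\tau_\theta+\nu_\theta}2\bigr)$. A sequence of configurations $\omega_N$ with $|\omega_N|=N$ is equidistributed if the normalized counting measures $\nu_N(A)=\frac1N|A\cap\omega_N|$ converge weak-star to $\sigma$ (i.e. $\int f\,d\nu_N\to\int f\,d\sigma$ for all continuous $f$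 on $\mathbb{S}^2$). For a finite configuration $\omega$ with at least two points, $\delta(\omega)=\min_{x\ne y\in\omega}|x-y|$, $\eta(\omega)=\max_{y\in\mathbb{S}^2}\min_{x\in\omega}|x-y|$, and $\gamma(\omega)=\eta(\omega)/\delta(\omega)$ is the mesh ratio. A sequence of configurations is quasi-uniform if its sequence of mesh ratios is bounded. *)

theory Defs
  imports "HOL-Analysis.Analysis" "HOL-Probability.Probability_Measure"
begin

subsection \<open>The sphere and its normalized surface measure\<close>

abbreviation S2 :: "(real ^ 3) set" where
  "S2 \<equiv> sphere 0 1"

definition spherical :: "real \<Rightarrow> real \<Rightarrow> real ^ 3" where
  "spherical \<phi> \<theta> = vector [sin \<phi> * cos \<theta>, sin \<phi> * sin \<theta>, cos \<phi>]"

lemma spherical_nth [simp]: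
  "spherical \<phi> \<theta> $ 1 = sin \<phi> * cos \<theta>"
  "spherical \<phi> \<theta> $ 2 = sin \<phi> * sin \<theta>"
  "spherical \<phi> \<theta> $ 3 = cos \<phi>"
  by (simp_all add: spherical_def)

lemma norm_spherical [simp]: "norm (spherical \<phi> \<theta>) = 1"
proof -
  have "(sin \<phi> * cos \<theta>)\<^sup>2 + (sin \<phi> * sin \<theta>)\<^sup>2 + (cos \<phi>)\<^sup>2
      = (sin \<phi>)\<^sup>2 * ((sin \<theta>)\<^sup>2 + (cos \<theta>)\<^sup>2) + (cos \<phi>)\<^sup>2"
    by (simp only: power_mult_distrib distrib_left add_ac)
  also have "\<dots> = 1" by simp
  finally show ?thesis
    by (simp add: norm_eq_sqrt_inner inner_vec_def sum_3 power2_eq_square)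
qed

lemma continuous_spherical: "continuous_on A (\<lambda>(\<phi>, \<theta>). spherical \<phi> \<theta>)"
proof -
  have "(\<lambda>(\<phi>, \<theta>). spherical \<phi> \<theta>) = (\<lambda>p. \<chi> i. spherical (fst p) (snd p) $ i)"
    by (auto simp: fun_eq_iff)
  moreover have "continuous_on A (\<lambda>p. spherical (fst p) (snd p) $ i)" for i
    using exhaust_3[of i]
    by (elim disjE; simp only: spherical_nth; intro continuous_intros)
  ultimately show ?thesis
    by (simp only: continuous_on_vec_lambda)
qed

text \<open>
  The area element of the parametrization \<open>spherical\<close> is \<open>sin \<phi>\<close>; see
  \<open>spherical_area_element\<close>.  The target \<open>\<sigma>\<close>-algebra is the Borel algebra of \<open>S2\<close>,
  so functions that are continuous merely on \<open>S2\<close> are measurable.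
\<close>

definition sphere_measure :: "(real ^ 3) measure" where
  "sphere_measure =
     distr
       (density lborel
         (\<lambda>(\<phi>, \<theta>). indicator ({0..pi} \<times> {0..2 * pi}) (\<phi>, \<theta>) * ennreal (sin \<phi> / (4 * pi))))
       (restrict_space borel S2)
       (\<lambda>(\<phi>, \<theta>). spherical \<phi> \<theta>)"

lemma spherical_area_element:
  fixes \<phi> \<theta> :: real
  assumes "0 \<le> \<phi>" "\<phi> \<le> pi"
  defines "u \<equiv> vector [cos \<phi> * cos \<theta>, cos \<phi> * sin \<theta>, - sin \<phi>] :: real ^ 3"
    and "v \<equiv> vector [- sin \<phi> * sin \<theta>, sin \<phi> * cos \<theta>, 0] :: real ^ 3"
  shows "((\<lambda>s. spherical s \<theta>) has_vector_derivative u) (at \<phi>)"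
    and "((\<lambda>t. spherical \<phi> t) has_vector_derivative v) (at \<theta>)"
    and "norm (cross3 u v) = sin \<phi>"
proof -
  have *: "(f has_vector_derivative d) (at x)"
    if "\<And>i. ((\<lambda>t. f t $ i) has_vector_derivative d $ i) (at x)"
    for f :: "real \<Rightarrow> real ^ 3" and d x
    using that unfolding has_vector_derivative_def
    by (subst has_derivative_componentwise_within)
       (auto simp: Basis_vec_def inner_axis)
  show "((\<lambda>s. spherical s \<theta>) has_vector_derivative u) (at \<phi>)"
  proof (rule *)
    fix i :: 3
    show "((\<lambda>t. spherical t \<theta> $ i) has_vector_derivative u $ i) (at \<phi>)"
      using exhaust_3[of i]
      by (auto simp: u_def has_real_derivative_iff_has_vector_derivative[symmetric]
          intro!: derivative_eq_intros)
  qed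
  show "((\<lambda>t. spherical \<phi> t) has_vector_derivative v) (at \<theta>)"
  proof (rule *)
    fix i :: 3
    show "((\<lambda>t. spherical \<phi> t $ i) has_vector_derivative v $ i) (at \<theta>)"
      using exhaust_3[of i]
      by (auto simp: v_def has_real_derivative_iff_has_vector_derivative[symmetric]
          intro!: derivative_eq_intros)
  qed
  have "cross3 u v = sin \<phi> *\<^sub>R spherical \<phi> \<theta>"
  proof -
    have "cos \<phi> * cos \<theta> * (sin \<phi> * cos \<theta>) + cos \<phi> * sin \<theta> * (sin \<phi> * sin \<theta>)
       = sin \<phi> * cos \<phi> * ((sin \<theta>)\<^sup>2 + (cos \<theta>)\<^sup>2)"
      by (simp only: power2_eq_square algebra_simps)
    then show ?thesis
      by (simp add: vec_eq_iff forall_3 cross3_def u_def v_def algebra_simps)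
  qed
  then show "norm (cross3 u v) = sin \<phi>"
    using assms sin_ge_zero by simp
qed

lemma measurable_spherical [measurable]:
  "(\<lambda>(\<phi>, \<theta>). spherical \<phi> \<theta>) \<in> measurable borel (restrict_space borel S2)"
  by (rule measurable_restrict_space2)
     (auto intro: borel_measurable_continuous_onI continuous_spherical)

lemma prob_space_sphere_measure: "prob_space sphere_measure"
proof -
  let ?g = "\<lambda>\<phi>. indicator {0..pi} \<phi> * ennreal (sin \<phi> / (4 * pi))"
  have meas: "(\<lambda>(\<phi>, \<theta>). indicator ({0..pi} \<times> {0..2 * pi}) (\<phi>, \<theta>) * ennreal (sin \<phi> / (4 * pi)))
      \<in> borel_measurable (borel :: (real \<times> real) measure)"
    by (simp add: borel_prod[symmetric])
  have *: "(\<integral>\<^sup>+ \<phi>. ?g \<phi> \<partial>lborel) = ennreal (1 / (2 * pi))"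
  proof -
    have "(\<integral>\<^sup>+ \<phi>. ennreal (sin \<phi> / (4 * pi)) * indicator {0..pi} \<phi> \<partial>lborel)
        = ennreal (- cos pi / (4 * pi) - (- cos 0 / (4 * pi)))"
      by (rule nn_integral_FTC_Icc) (auto intro!: derivative_eq_intros divide_nonneg_nonneg sin_ge_zero)
    then show ?thesis by (simp add: mult.commute field_simps)
  qed
  have "(\<integral>\<^sup>+ p. (case p of (\<phi>, \<theta>) \<Rightarrow>
           indicator ({0..pi} \<times> {0..2 * pi}) (\<phi>, \<theta>) * ennreal (sin \<phi> / (4 * pi))) \<partial>lborel)
      = (\<integral>\<^sup>+ \<phi>. \<integral>\<^sup>+ \<theta>. ?g \<phi> * indicator {0..2 * pi} \<theta> \<partial>lborel \<partial>lborel)"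
    unfolding lborel_prod[symmetric]
    by (subst lborel.nn_integral_fst[symmetric])
       (auto intro!: nn_integral_cong simp: indicator_times mult_ac)
  also have "\<dots> = (\<integral>\<^sup>+ \<phi>. ?g \<phi> \<partial>lborel) * ennreal (2 * pi)"
    by (simp add: nn_integral_cmult nn_integral_multc)
  also have "\<dots> = 1"
    unfolding * by (subst ennreal_mult[symmetric]) auto
  finally have "prob_space (density lborel
      (\<lambda>(\<phi>, \<theta>). indicator ({0..pi} \<times> {0..2 * pi}) (\<phi>, \<theta>) * ennreal (sin \<phi> / (4 * pi))))"
    using meas by (intro prob_spaceI) (simp add: emeasure_density)
  then show ?thesis
    unfolding sphere_measure_def by (rule prob_space.prob_space_distr) simp
qed

subsection \<open>The zonal equal area partition\<close>

text \<open>
  The half-integer ties left open by ``nearest integer'' are resolved by the library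
  function \<open>round\<close>, i.e. upwards.
\<close>

definition cap_angle :: "nat \<Rightarrow> real" where
  "cap_angle N = arccos (1 - 2 / real N)"

definition ideal_collar_angle :: "nat \<Rightarrow> real" where
  "ideal_collar_angle N = sqrt (4 * pi / real N)"

definition ideal_num_collars :: "nat \<Rightarrow> real" where
  "ideal_num_collars N = (pi - 2 * cap_angle N) / ideal_collar_angle N"

definition num_collars :: "nat \<Rightarrow> nat" where
  "num_collars N = (if N = 2 then 0 else nat (max 1 (round (ideal_num_collars N))))"

definition fitting_collar_angle :: "nat \<Rightarrow> real" where
  "fitting_collar_angle N = (pi - 2 * cap_angle N) / real (num_collars N)"

definition fitting_collar_area :: "nat \<Rightarrow> nat \<Rightarrow> real" where
  "fitting_collar_area N j =
     2 * pi * (cos (cap_angle N + (real j - 2) * fitting_collar_angle N)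
             - cos (cap_angle N + (real j - 1) * fitting_collar_angle N))"

definition ideal_num_cells :: "nat \<Rightarrow> nat \<Rightarrow> real" where
  "ideal_num_cells N j = (if j = 1 then 1 else real N * fitting_collar_area N j / (4 * pi))"

text \<open>
  Collar \<open>1\<close> is the north polar cap, and the non-polar collars are those with index in
  \<open>{2..num_collars N + 1}\<close>; the values at other indices are irrelevant.
\<close>

function num_cells :: "nat \<Rightarrow> nat \<Rightarrow> int"
  and discrepancy :: "nat \<Rightarrow> nat \<Rightarrow> real"
where
  "num_cells N j =
     (if j \<le> 1 then 1 else round (ideal_num_cells N j + discrepancy N (j - 1)))"
| "discrepancy N j =
     (if j \<le> 1 then 0 else (\<Sum>k = 1..j. ideal_num_cells N k - real_of_int (num_cells N k)))"
  by pat_completeness auto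
termination
  by (relation "Wellfounded.measure (case_sum (\<lambda>(N, j). 2 * j) (\<lambda>(N, j). 2 * j + 1))") auto

declare num_cells.simps [simp del] discrepancy.simps [simp del]

definition colatitude :: "nat \<Rightarrow> nat \<Rightarrow> real" where
  "colatitude N j =
     (if j = 0 then 0
      else if j = num_collars N + 2 then pi
      else arccos (1 - 2 / real N * (\<Sum>k = 1..j. real_of_int (num_cells N k))))"

text \<open>
  A cell carries its bounding angles, since the center of a cell is defined in terms of
  these.  Taking the image under \<open>spherical\<close> makes azimuths count modulo \<open>2 * pi\<close>.
\<close>

datatype cell =
    North_Cap real
  | South_Cap real
  | Collar_Cell real real real real

definition spherical_rectangle :: "real \<Rightarrow> real \<Rightarrow> real \<Rightarrow> real \<Rightarrow> (real ^ 3) set" where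
  "spherical_rectangle \<tau>\<phi> \<nu>\<phi> \<tau>\<theta> \<nu>\<theta> =
     {spherical \<phi> \<theta> | \<phi> \<theta>. \<tau>\<phi> \<le> \<phi> \<and> \<phi> \<le> \<nu>\<phi> \<and> \<tau>\<theta> \<le> \<theta> \<and> \<theta> \<le> \<nu>\<theta>}"

primrec cell_region :: "cell \<Rightarrow> (real ^ 3) set" where
  "cell_region (North_Cap \<nu>\<phi>) = spherical_rectangle 0 \<nu>\<phi> 0 (2 * pi)"
| "cell_region (South_Cap \<tau>\<phi>) = spherical_rectangle \<tau>\<phi> pi 0 (2 * pi)"
| "cell_region (Collar_Cell \<tau>\<phi> \<nu>\<phi> \<tau>\<theta> \<nu>\<theta>) = spherical_rectangle \<tau>\<phi> \<nu>\<phi> \<tau>\<theta> \<nu>\<theta>"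

primrec cell_center :: "cell \<Rightarrow> real ^ 3" where
  "cell_center (North_Cap \<nu>\<phi>) = vector [0, 0, 1]"
| "cell_center (South_Cap \<tau>\<phi>) = vector [0, 0, -1]"
| "cell_center (Collar_Cell \<tau>\<phi> \<nu>\<phi> \<tau>\<theta> \<nu>\<theta>) = spherical ((\<tau>\<phi> + \<nu>\<phi>) / 2) ((\<tau>\<theta> + \<nu>\<theta>) / 2)"

definition collar_cells :: "nat \<Rightarrow> (nat \<Rightarrow> real) \<Rightarrow> nat \<Rightarrow> cell set" where
  "collar_cells N \<theta> j =
     (let y = real_of_int (num_cells N j) in
      {Collar_Cell (colatitude N (j - 1)) (colatitude N j)
         (\<theta> j + real_of_int k * (2 * pi / y)) (\<theta> j + (real_of_int k + 1) * (2 * pi / y))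
       | k. 0 \<le> k \<and> k \<le> num_cells N j - 1})"

definition zonal_partition :: "nat \<Rightarrow> (nat \<Rightarrow> real) \<Rightarrow> cell set" where
  "zonal_partition N \<theta> =
     {North_Cap (colatitude N 1), South_Cap (colatitude N (num_collars N + 1))}
     \<union> (\<Union>j\<in>{2..num_collars N + 1}. collar_cells N \<theta> j)"

definition zonal_configuration :: "nat \<Rightarrow> (real ^ 3) set \<Rightarrow> bool" where
  "zonal_configuration N \<omega> \<longleftrightarrow>
     (\<exists>\<theta>. (\<forall>j\<in>{2..num_collars N + 1}. 0 \<le> \<theta> j \<and> \<theta> j < 2 * pi)
        \<and> \<omega> = cell_center ` zonal_partition N \<theta>)"

subsection \<open>Equidistribution and quasi-uniformity\<close>

text \<open>Sequences of configurations are indexed by \<open>N \<ge> 2\<close>; the values at \<open>0\<close> and \<open>1\<close> are ignored.\<close>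

definition normalized_counting_measure :: "(real ^ 3) set \<Rightarrow> (real ^ 3) measure" where
  "normalized_counting_measure \<omega> =
     distr (uniform_count_measure \<omega>) (restrict_space borel S2) (\<lambda>x. x)"

lemma measure_normalized_counting_measure:
  assumes "finite \<omega>" "\<omega> \<subseteq> S2" "A \<in> sets (restrict_space borel S2)"
  shows "measure (normalized_counting_measure \<omega>) A = real (card (A \<inter> \<omega>)) / real (card \<omega>)"
proof -
  have "(\<lambda>x. x) \<in> measurable (uniform_count_measure \<omega>) (restrict_space borel S2)"
    using assms(2) by (auto simp: measurable_def space_restrict_space
        space_uniform_count_measure sets_uniform_count_measure)
  then show ?thesis
    using assms unfolding normalized_counting_measure_def
    by (subst measure_distr)
       (auto simp: space_uniform_count_measure measure_uniform_count_measure)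
qed

definition weak_star_convergent :: "(nat \<Rightarrow> (real ^ 3) measure) \<Rightarrow> (real ^ 3) measure \<Rightarrow> bool" where
  "weak_star_convergent \<mu> \<nu> \<longleftrightarrow>
     (\<forall>f :: real ^ 3 \<Rightarrow> real. continuous_on S2 f \<longrightarrow>
        (\<lambda>N. integral\<^sup>L (\<mu> N) f) \<longlonglongrightarrow> integral\<^sup>L \<nu> f)"

definition equidistributed :: "(nat \<Rightarrow> (real ^ 3) set) \<Rightarrow> bool" where
  "equidistributed \<omega> \<longleftrightarrow>
     (\<forall>N\<ge>2. \<omega> N \<subseteq> S2 \<and> finite (\<omega> N) \<and> card (\<omega> N) = N) \<and>
     weak_star_convergent (\<lambda>N. normalized_counting_measure (\<omega> N)) sphere_measure"

definition separation :: "(real ^ 3) set \<Rightarrow> real" where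
  "separation \<omega> = Min {norm (x - y) | x y. x \<in> \<omega> \<and> y \<in> \<omega> \<and> x \<noteq> y}"

definition covering_radius :: "(real ^ 3) set \<Rightarrow> real" where
  "covering_radius \<omega> = (SUP y\<in>S2. Min ((\<lambda>x. norm (x - y)) ` \<omega>))"

definition mesh_ratio :: "(real ^ 3) set \<Rightarrow> real" where
  "mesh_ratio \<omega> = covering_radius \<omega> / separation \<omega>"

definition quasi_uniform :: "(nat \<Rightarrow> (real ^ 3) set) \<Rightarrow> bool" where
  "quasi_uniform \<omega> \<longleftrightarrow>
     (\<forall>N\<ge>2. \<omega> N \<subseteq> S2 \<and> finite (\<omega> N) \<and> 2 \<le> card (\<omega> N)) \<and>
     bounded ((\<lambda>N. mesh_ratio (\<omega> N)) ` {2..})"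

end

theory Submission
  imports Defs "HOL-Real_Asymp.Real_Asymp"
begin

text \<open>
  Since \<open>\<sigma>\<close> of a spherical rectangle is proportional to the difference of the cosines of its
  bounding colatitudes, the number of cells in a collar of height \<open>h\<close> and middle colatitude \<open>m\<close>
  is \<open>N sin m sin (h / 2)\<close>; hence its cells have width \<open>2\<pi> sin m / y = 2\<pi> / (N sin (h / 2))\<close>, and
  everything follows once all collar heights are of the order \<open>1 / \<surd>N\<close>: the width is then of the
  same order, which bounds both the separation and the covering radius, and cells of equal measure
  and vanishing diameter yield equidistribution by uniform continuity.

  The ideal collars have height of order \<open>1 / \<surd>N\<close> by construction.  The rounding discrepancy never
  exceeds \<open>1 / 2\<close>, while every ideal number of cells is at least \<open>1\<close>.  So the numbers of cells, and
  the numbers of cells above and below each boundary circle, change by at most a factor \<open>2\<close>; hence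
  so does the sine of the boundary colatitudes, and therefore the heights change by at most a
  constant factor.
\<close>

subsection \<open>Distances on the sphere\<close>

text \<open>Jordan's inequality: sine is concave on \<open>{0..pi / 2}\<close> and so lies above its
  chord. Together with \<open>sin x \<le> x\<close> it trades sines for angles at the cost of a
  constant factor.\<close>

lemma two_over_pi_le_sin:
  fixes x :: real
  assumes "0 \<le> x" "x \<le> pi / 2"
  shows "2 / pi * x \<le> sin x"
proof -
  have "concave_on {0..pi / 2} sin"
    unfolding concave_on_def
  proof (rule f''_ge0_imp_convex)
    show "convex {0..pi / 2 :: real}" by simp
    show "((\<lambda>x. - sin x) has_real_derivative - cos x) (at x)" for x :: real
      by (auto intro!: derivative_eq_intros)
    show "((\<lambda>x. - cos x) has_real_derivative sin x) (at x)" for x :: real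
      by (auto intro!: derivative_eq_intros)
    show "0 \<le> sin x" if "x \<in> {0..pi / 2}" for x :: real
      using that pi_ge_zero by (intro sin_ge_zero) auto
  qed
  then have "(1 - 2 * x / pi) * sin 0 + (2 * x / pi) * sin (pi / 2)
      \<le> sin ((1 - 2 * x / pi) *\<^sub>R 0 + (2 * x / pi) *\<^sub>R (pi / 2))"
    using assms by (intro concave_onD) (auto simp: divide_simps)
  then show ?thesis by (simp add: mult.commute)
qed

lemma norm_spherical_diff_sq:
  "(norm (spherical a \<alpha> - spherical b \<beta>))\<^sup>2
     = (2 * sin ((a - b) / 2))\<^sup>2 + 4 * sin a * sin b * (sin ((\<alpha> - \<beta>) / 2))\<^sup>2"
proof -
  have half: "2 * (sin (z / 2))\<^sup>2 = 1 - cos z" for z :: real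
    using cos_double_sin[of "z / 2"] by simp
  have "(norm (spherical a \<alpha> - spherical b \<beta>))\<^sup>2
      = 2 - 2 * (spherical a \<alpha> \<bullet> spherical b \<beta>)"
    using dot_norm_neg[of "spherical a \<alpha>" "spherical b \<beta>"] by simp
  also have "spherical a \<alpha> \<bullet> spherical b \<beta> = sin a * sin b * cos (\<alpha> - \<beta>) + cos a * cos b"
    by (simp add: inner_vec_def sum_3 cos_diff algebra_simps)
  also have "2 - 2 * (sin a * sin b * cos (\<alpha> - \<beta>) + cos a * cos b)
      = 2 * (1 - cos (a - b)) + 2 * sin a * sin b * (1 - cos (\<alpha> - \<beta>))"
    by (simp add: cos_diff algebra_simps)
  finally show ?thesis
    by (simp add: half[symmetric] power2_eq_square algebra_simps)
qed

text \<open>Drop the azimuthal part and apply Jordan's inequality to half the difference, which is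
  at most \<open>pi / 2\<close>.\<close>

lemma norm_spherical_diff_ge_colatitude:
  assumes "0 \<le> a" "a \<le> pi" "0 \<le> b" "b \<le> pi"
  shows "2 / pi * \<bar>a - b\<bar> \<le> norm (spherical a \<alpha> - spherical b \<beta>)"
proof -
  have "2 / pi * \<bar>a - b\<bar> \<le> 2 * sin (\<bar>a - b\<bar> / 2)"
    using two_over_pi_le_sin[of "\<bar>a - b\<bar> / 2"] assms by (auto simp: field_simps)
  also have "\<dots> \<le> \<bar>2 * sin ((a - b) / 2)\<bar>"
    by (cases "a \<le> b") (use sin_minus[of "(a - b) / 2"] in \<open>auto simp: minus_divide_left\<close>)
  also have "\<dots> \<le> norm (spherical a \<alpha> - spherical b \<beta>)"
  proof (rule abs_le_square_iff[THEN iffD2, of _ "norm _", simplified])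
    show "(2 * sin ((a - b) / 2))\<^sup>2 \<le> (norm (spherical a \<alpha> - spherical b \<beta>))\<^sup>2"
      unfolding norm_spherical_diff_sq using assms by (simp add: sin_ge_zero)
  qed
  finally show ?thesis .
qed

lemma norm_spherical_diff_same_colatitude:
  assumes "0 \<le> a" "a \<le> pi"
  shows "norm (spherical a \<alpha> - spherical a \<beta>) = 2 * sin a * \<bar>sin ((\<alpha> - \<beta>) / 2)\<bar>"
proof -
  have "(norm (spherical a \<alpha> - spherical a \<beta>))\<^sup>2 = (2 * sin a * \<bar>sin ((\<alpha> - \<beta>) / 2)\<bar>)\<^sup>2"
    unfolding norm_spherical_diff_sq by (simp add: power2_eq_square)
  then show ?thesis
    using assms by (auto simp: sin_ge_zero intro: power2_eq_imp_eq)
qed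

text \<open>Go first along a meridian, then along the circle of colatitude \<open>b\<close>. The
  factor \<open>sin b\<close> must be kept: near the poles cells span large azimuth ranges on short
  circles.\<close>

lemma norm_spherical_diff_le:
  assumes "0 \<le> b" "b \<le> pi"
  shows "norm (spherical a \<alpha> - spherical b \<beta>) \<le> \<bar>a - b\<bar> + sin b * \<bar>\<alpha> - \<beta>\<bar>"
proof -
  have sin_half: "2 * \<bar>sin (z / 2)\<bar> \<le> \<bar>z\<bar>" for z :: real
    using abs_sin_x_le_abs_x[of "z / 2"] by simp
  have "norm (spherical a \<alpha> - spherical b \<beta>)
      \<le> norm (spherical a \<alpha> - spherical b \<alpha>) + norm (spherical b \<alpha> - spherical b \<beta>)"
    by norm
  also have "norm (spherical a \<alpha> - spherical b \<alpha>) = 2 * \<bar>sin ((a - b) / 2)\<bar>"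
  proof (rule power2_eq_imp_eq)
    show "(norm (spherical a \<alpha> - spherical b \<alpha>))\<^sup>2 = (2 * \<bar>sin ((a - b) / 2)\<bar>)\<^sup>2"
      unfolding norm_spherical_diff_sq by (simp add: power_mult_distrib)
  qed simp_all
  also have "\<dots> \<le> \<bar>a - b\<bar>"
    by (rule sin_half)
  also have "norm (spherical b \<alpha> - spherical b \<beta>) = sin b * (2 * \<bar>sin ((\<alpha> - \<beta>) / 2)\<bar>)"
    using norm_spherical_diff_same_colatitude[OF assms] by simp
  also have "\<dots> \<le> sin b * \<bar>\<alpha> - \<beta>\<bar>"
    using assms by (intro mult_left_mono sin_half sin_ge_zero)
  finally show ?thesis by simp
qed

lemma sphere_eq_spherical:
  assumes "x \<in> S2"
  obtains \<phi> \<theta> where "0 \<le> \<phi>" "\<phi> \<le> pi" "x = spherical \<phi> \<theta>"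
proof -
  have sq: "(x $ 1)\<^sup>2 + (x $ 2)\<^sup>2 + (x $ 3)\<^sup>2 = 1"
    using assms by (simp add: norm_eq_sqrt_inner inner_vec_def sum_3 power2_eq_square)
  define \<phi> where "\<phi> = arccos (x $ 3)"
  have "(x $ 3)\<^sup>2 \<le> 1" using sq by (smt (verit) zero_le_power2)
  then have x3: "-1 \<le> x $ 3" "x $ 3 \<le> 1"
    by (auto simp: abs_square_le_1 abs_le_iff)
  then have \<phi>: "0 \<le> \<phi>" "\<phi> \<le> pi" "cos \<phi> = x $ 3"
    by (auto simp: \<phi>_def arccos_lbound arccos_ubound)
  have s: "(x $ 1)\<^sup>2 + (x $ 2)\<^sup>2 = (sin \<phi>)\<^sup>2"
    using sq sin_squared_eq[of \<phi>] \<phi>(3) by simp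
  obtain \<theta> where "x $ 1 = sin \<phi> * cos \<theta>" "x $ 2 = sin \<phi> * sin \<theta>"
  proof (cases "sin \<phi> = 0")
    case True
    \<comment> \<open>The point is a pole, where any azimuth serves.\<close>
    then show ?thesis using s that[of 0] by (simp add: sum_power2_eq_zero_iff)
  next
    case False
    then have "(x $ 1 / sin \<phi>)\<^sup>2 + (x $ 2 / sin \<phi>)\<^sup>2 = 1"
      using s by (simp add: power_divide flip: add_divide_distrib)
    then obtain \<theta> where "x $ 1 / sin \<phi> = cos \<theta>" "x $ 2 / sin \<phi> = sin \<theta>"
      by (metis sincos_total_2pi)
    then show ?thesis using that[of \<theta>] False by (simp add: field_simps)
  qed
  then show ?thesis
    using that[of \<phi> \<theta>] \<phi> by (simp add: vec_eq_iff forall_3)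
qed

lemma spherical_periodic: "spherical \<phi> (\<theta> + 2 * pi * of_int k) = spherical \<phi> \<theta>"
proof -
  have "cos (\<theta> + 2 * pi * of_int k) = cos \<theta>" "sin (\<theta> + 2 * pi * of_int k) = sin \<theta>"
    by (simp_all add: cos_add sin_add)
  then show ?thesis
    by (simp add: spherical_def)
qed

subsection \<open>Equal area grids with given collars\<close>

text \<open>Compare \<open>f\<close> with the step function that takes the value \<open>v i\<close>
  on \<open>Q i\<close>. The value belongs to the index rather than to a point of
  \<open>Q i\<close>, because the center later assigned to a tile need not lie in the image of that
  tile.\<close>

lemma (in prob_space) expectation_partition_approx:
  fixes f :: "'a \<Rightarrow> real"
  assumes I: "finite I" "I \<noteq> {}"
    and Q: "\<And>i. i \<in> I \<Longrightarrow> Q i \<in> events" "disjoint_family_on Q I"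
    and prob_Q: "\<And>i. i \<in> I \<Longrightarrow> prob (Q i) = 1 / real (card I)"
    and f: "integrable M f"
    and approx: "\<And>i x. i \<in> I \<Longrightarrow> x \<in> Q i \<Longrightarrow> \<bar>f x - v i\<bar> \<le> \<epsilon>"
  shows "\<bar>expectation f - (\<Sum>i\<in>I. v i) / real (card I)\<bar> \<le> \<epsilon>"
proof -
  define g where "g x = (\<Sum>i\<in>I. v i * indicator (Q i) x)" for x
  have int_g: "integrable M g"
    unfolding g_def using Q(1)
    by (intro Bochner_Integration.integrable_sum integrable_mult_right integrable_real_indicator)
       (auto simp: emeasure_eq_measure)
  have "expectation g = (\<Sum>i\<in>I. expectation (\<lambda>x. v i * indicator (Q i) x))"
    unfolding g_def using Q(1)
    by (intro Bochner_Integration.integral_sum integrable_mult_right integrable_real_indicator)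
       (auto simp: emeasure_eq_measure)
  also have "\<dots> = (\<Sum>i\<in>I. v i) / real (card I)"
    using Q prob_Q by (simp add: sum_divide_distrib)
  finally have exp_g: "expectation g = (\<Sum>i\<in>I. v i) / real (card I)" .
  \<comment> \<open>The parts are not assumed to cover the space, but their probabilities add up to
    one, so they cover almost all of it.\<close>
  have "prob (\<Union>i\<in>I. Q i) = (\<Sum>i\<in>I. prob (Q i))"
    using I Q by (intro finite_measure_finite_Union) auto
  then have "prob (\<Union>i\<in>I. Q i) = 1"
    using I prob_Q by simp
  then have "AE x in M. x \<in> (\<Union>i\<in>I. Q i)"
    by (intro prob_eq_1[THEN iffD1]) (use I Q in auto)
  then have close: "AE x in M. \<bar>f x - g x\<bar> \<le> \<epsilon>"
  proof eventually_elim
    case (elim x)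
    then obtain i where i: "i \<in> I" "x \<in> Q i" by blast
    have "g x = (\<Sum>k\<in>I. if k = i then v i else 0)"
      unfolding g_def using i Q(2)
      by (intro sum.cong) (auto simp: disjoint_family_on_def indicator_def)
    then have "g x = v i"
      using i I by simp
    then show ?case using approx i by simp
  qed
  have "\<bar>expectation f - expectation g\<bar> = \<bar>expectation (\<lambda>x. f x - g x)\<bar>"
    using f int_g by simp
  also have "\<dots> \<le> expectation (\<lambda>x. \<bar>f x - g x\<bar>)"
    by (rule integral_abs_bound)
  also have "\<dots> \<le> expectation (\<lambda>_. \<epsilon>)"
    using f int_g close by (intro integral_mono_AE) auto
  finally show ?thesis by (simp add: exp_g prob_space)
qed

section \<open>The surface measure in polar coordinates\<close>

definition polar_measure :: "(real \<times> real) measure" where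
  "polar_measure = density lborel
     (\<lambda>(\<phi>, \<theta>). indicator ({0..pi} \<times> {0..2 * pi}) (\<phi>, \<theta>) * ennreal (sin \<phi> / (4 * pi)))"

lemma sphere_measure_eq_distr:
  "sphere_measure = distr polar_measure (restrict_space borel S2) (\<lambda>(\<phi>, \<theta>). spherical \<phi> \<theta>)"
  by (simp add: sphere_measure_def polar_measure_def)

lemma sets_polar_measure [measurable_cong]: "sets polar_measure = sets borel"
  by (simp add: polar_measure_def)

text \<open>The density \<open>sin\<close> integrates to a difference of cosines. The rectangles are
  half-open so that neighbouring tiles are disjoint; the missing sides are null sets.\<close>

lemma emeasure_polar_rectangle:
  assumes "0 \<le> a" "a \<le> b" "b \<le> pi" "0 \<le> c" "c \<le> d" "d \<le> 2 * pi"
  shows "emeasure polar_measure ({a<..b} \<times> {c..<d}) = ennreal ((cos a - cos b) * (d - c) / (4 * pi))"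
proof -
  let ?w = "\<lambda>(\<phi>, \<theta>). indicator ({0..pi} \<times> {0..2 * pi}) (\<phi>, \<theta>) * ennreal (sin \<phi> / (4 * pi))"
  let ?g = "\<lambda>\<phi>. ennreal (sin \<phi> / (4 * pi)) * indicator {a<..b} \<phi>"
  have [measurable]: "?w \<in> borel_measurable (borel :: (real \<times> real) measure)"
    by (simp add: borel_prod[symmetric])
  have [measurable]: "{a<..b} \<times> {c..<d} \<in> sets (borel :: (real \<times> real) measure)"
    by (simp add: borel_prod[symmetric])
  have "(\<integral>\<^sup>+ \<phi>. ?g \<phi> \<partial>lborel)
      = (\<integral>\<^sup>+ \<phi>. ennreal (sin \<phi> / (4 * pi)) * indicator {a..b} \<phi> \<partial>lborel)"
  proof (intro nn_integral_cong_AE)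
    show "AE \<phi> in lborel. ?g \<phi> = ennreal (sin \<phi> / (4 * pi)) * indicator {a..b} \<phi>"
      using AE_lborel_singleton[of a] by eventually_elim (auto simp: indicator_def)
  qed
  also have "\<dots> = ennreal (- cos b / (4 * pi) - (- cos a / (4 * pi)))"
    using assms
    by (intro nn_integral_FTC_Icc)
       (auto intro!: derivative_eq_intros divide_nonneg_nonneg sin_ge_zero)
  finally have g: "(\<integral>\<^sup>+ \<phi>. ?g \<phi> \<partial>lborel) = ennreal ((cos a - cos b) / (4 * pi))"
    by (simp add: diff_divide_distrib)
  have "emeasure polar_measure ({a<..b} \<times> {c..<d})
      = (\<integral>\<^sup>+ p. ?w p * indicator ({a<..b} \<times> {c..<d}) p \<partial>lborel)"
    unfolding polar_measure_def by (intro emeasure_density) simp_all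
  also have "\<dots> = (\<integral>\<^sup>+ \<phi>. \<integral>\<^sup>+ \<theta>. ?g \<phi> * indicator {c..<d} \<theta> \<partial>lborel \<partial>lborel)"
    unfolding lborel_prod[symmetric]
    by (subst lborel.nn_integral_fst[symmetric])
       (use assms in \<open>auto intro!: nn_integral_cong simp: indicator_def\<close>)
  also have "\<dots> = (\<integral>\<^sup>+ \<phi>. ?g \<phi> \<partial>lborel) * ennreal (d - c)"
    using assms by (simp add: nn_integral_cmult nn_integral_multc)
  also have "\<dots> = ennreal ((cos a - cos b) / (4 * pi) * (d - c))"
    unfolding g using assms by (intro ennreal_mult[symmetric]) (auto simp: cos_mono_le_eq)
  finally show ?thesis by simp
qed

section \<open>Grids with prescribed collars: cell counts and centers\<close>

lemma sum_consecutive_diff: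
  fixes g :: "nat \<Rightarrow> real"
  shows "(\<Sum>j = 1..m. g (j - 1) - g j) = g 0 - g m"
  by (induction m) auto

text \<open>This isolates what the geometry uses: boundaries \<open>\<Phi>\<close> and cell counts
  \<open>y\<close> that match in area, with starting angles \<open>t\<close>. The rounding procedure
  is left out, and the caps count as collars with one cell, so sums over collars need no special
  terms.\<close>

locale zonal_grid =
  fixes N n :: nat and y :: "nat \<Rightarrow> nat" and \<Phi> t :: "nat \<Rightarrow> real"
  assumes N_pos: "N > 0"
    and \<Phi>_first: "\<Phi> 0 = 0"
    and \<Phi>_last: "\<Phi> (n + 2) = pi"
    and \<Phi>_range: "\<And>j. j \<le> n + 2 \<Longrightarrow> 0 \<le> \<Phi> j \<and> \<Phi> j \<le> pi"
    and y_pos: "\<And>j. j \<in> {1..n + 2} \<Longrightarrow> y j > 0"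
    and y_caps: "y 1 = 1" "y (n + 2) = 1"
    and area: "\<And>j. j \<in> {1..n + 2} \<Longrightarrow> cos (\<Phi> (j - 1)) - cos (\<Phi> j) = 2 * real (y j) / real N"
begin

definition gap :: "nat \<Rightarrow> real" where
  "gap j = \<Phi> j - \<Phi> (j - 1)"

definition mid :: "nat \<Rightarrow> real" where
  "mid j = (if j = 1 then 0 else if j = n + 2 then pi else (\<Phi> (j - 1) + \<Phi> j) / 2)"

definition center :: "nat \<Rightarrow> int \<Rightarrow> real ^ 3" where
  "center j k = spherical (mid j) (t j + (2 * of_int k + 1) * pi / real (y j))"

definition index :: "(nat \<times> int) set" where
  "index = (SIGMA j:{1..n + 2}. {0..<int (y j)})"

definition config :: "(real ^ 3) set" where
  "config = (\<lambda>(j, k). center j k) ` index"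

text \<open>The areas telescope to \<open>cos 0 - cos pi = 2\<close>.\<close>

lemma sum_y: "(\<Sum>j = 1..n + 2. y j) = N"
proof -
  have "2 * real (\<Sum>j = 1..n + 2. y j) / real N = (\<Sum>j = 1..n + 2. 2 * real (y j) / real N)"
    by (simp only: of_nat_sum sum_distrib_left sum_divide_distrib)
  also have "\<dots> = (\<Sum>j = 1..n + 2. cos (\<Phi> (j - 1)) - cos (\<Phi> j))"
    by (intro sum.cong) (simp_all only: area)
  also have "\<dots> = 2"
    unfolding sum_consecutive_diff[of "\<lambda>j. cos (\<Phi> j)"] \<Phi>_first \<Phi>_last by simp
  finally have "real (\<Sum>j = 1..n + 2. y j) = real N"
    using N_pos by (simp add: field_simps del: of_nat_sum)
  then show ?thesis by (simp only: of_nat_eq_iff)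
qed

lemma finite_index: "finite index"
  by (simp add: index_def)

lemma card_index: "card index = N"
proof -
  have "card index = (\<Sum>j = 1..n + 2. y j)"
    unfolding index_def by (subst card_SigmaI) auto
  then show ?thesis by (simp only: sum_y)
qed

lemma gap_pos:
  assumes "j \<in> {1..n + 2}"
  shows "0 < gap j"
proof -
  have "0 < 2 * real (y j) / real N"
    using y_pos[OF assms] N_pos by simp
  then have "cos (\<Phi> j) < cos (\<Phi> (j - 1))"
    using area[OF assms] by simp
  moreover have "j \<le> n + 2" "j - 1 \<le> n + 2" using assms by auto
  ultimately show ?thesis
    using \<Phi>_range[of j] \<Phi>_range[of "j - 1"] by (simp add: gap_def cos_mono_less_eq)
qed

lemma \<Phi>_mono:
  assumes "i \<le> j" "j \<le> n + 2"
  shows "\<Phi> i \<le> \<Phi> j"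
  using assms
proof (induction j rule: dec_induct)
  case (step j)
  then show ?case using gap_pos[of "Suc j"] by (simp add: gap_def)
qed simp

lemma mid_bounds:
  assumes "j \<in> {1..n + 2}"
  shows "\<Phi> (j - 1) \<le> mid j" "mid j \<le> \<Phi> j"
  using gap_pos[OF assms] \<Phi>_first \<Phi>_last \<Phi>_range[of 1] \<Phi>_range[of "n + 1"]
  by (auto simp: mid_def gap_def field_simps)

lemma \<Phi>_range':
  assumes "j \<in> {1..n + 2}"
  shows "0 \<le> \<Phi> (j - 1)" "\<Phi> j \<le> pi"
proof -
  have "j - 1 \<le> n + 2" "j \<le> n + 2" using assms by auto
  then show "0 \<le> \<Phi> (j - 1)" "\<Phi> j \<le> pi" using \<Phi>_range by blast+
qed

lemma gap_le_pi:
  assumes "j \<in> {1..n + 2}"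
  shows "gap j \<le> pi"
  using \<Phi>_range'[OF assms] by (simp add: gap_def)

lemma mid_range:
  assumes "j \<in> {1..n + 2}"
  shows "0 \<le> mid j" "mid j \<le> pi"
  using mid_bounds[OF assms] \<Phi>_range'[OF assms] by linarith+

text \<open>The center of an inner collar is half a gap away from both of its boundaries, and a pole
  is a whole gap away from the boundary of its cap; so each of the two collars contributes at least
  \<open>h / 2\<close>.\<close>

lemma mid_diff_ge:
  assumes "i \<in> {1..n + 2}" "j \<in> {1..n + 2}" "i < j"
    and h: "\<And>j. j \<in> {1..n + 2} \<Longrightarrow> h \<le> gap j"
  shows "h \<le> mid j - mid i"
proof -
  have "mid i \<le> \<Phi> i - h / 2"
  proof (cases "i = 1")
    case True
    then show ?thesis
      using h[OF assms(1)] gap_pos[OF assms(1)] \<Phi>_first by (simp add: mid_def gap_def)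
  next
    case False
    then have "mid i = \<Phi> i - gap i / 2"
      using assms by (simp add: mid_def gap_def field_simps)
    then show ?thesis using h[OF assms(1)] by simp
  qed
  moreover have "\<Phi> (j - 1) + h / 2 \<le> mid j"
  proof (cases "j = n + 2")
    case True
    then show ?thesis
      using h[OF assms(2)] gap_pos[OF assms(2)] \<Phi>_last by (simp add: mid_def gap_def)
  next
    case False
    then have "mid j = \<Phi> (j - 1) + gap j / 2"
      using assms by (simp add: mid_def gap_def field_simps)
    then show ?thesis using h[OF assms(2)] by simp
  qed
  moreover have "\<Phi> i \<le> \<Phi> (j - 1)"
    using assms by (intro \<Phi>_mono) auto
  ultimately show ?thesis by simp
qed

text \<open>Sum-to-product applied to \<open>area\<close>. The caps are excluded because there
  \<open>mid\<close> is the pole and not the mean of the boundaries.\<close>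

lemma sin_mid:
  assumes "2 \<le> j" "j \<le> n + 1"
  shows "sin (mid j) * sin (gap j / 2) = real (y j) / real N"
  using area[of j] assms
  by (simp add: mid_def gap_def cos_diff_cos)

text \<open>The left side is half the width of a cell along the circle through the centers. Solving
  \<open>sin_mid\<close> for it leaves \<open>sin (gap j / 2)\<close> in the denominator, which is
  at least \<open>h / pi\<close> by Jordan's inequality; for the caps the left side is zero.\<close>

lemma sin_mid_le:
  assumes j: "j \<in> {1..n + 2}" and h: "0 < h" "h \<le> gap j"
  shows "sin (mid j) * (pi / real (y j)) \<le> pi\<^sup>2 / (real N * h)"
proof (cases "j = 1 \<or> j = n + 2")
  case True
  then show ?thesis using h by (auto simp: mid_def)
next
  case False
  have gap: "gap j \<le> pi"
    by (rule gap_le_pi[OF j])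
  have "h / pi \<le> sin (gap j / 2)"
    using two_over_pi_le_sin[of "gap j / 2"] h gap by (auto simp: field_simps)
  then have "sin (mid j) * (h / pi) \<le> sin (mid j) * sin (gap j / 2)"
    using mid_range[OF j] by (intro mult_left_mono sin_ge_zero)
  also have "\<dots> = real (y j) / real N"
    using sin_mid[of j] j False by auto
  finally show ?thesis
    using h N_pos y_pos[OF j] by (simp add: field_simps power2_eq_square)
qed

text \<open>Raising \<open>k\<close> by \<open>y j\<close> adds a full turn to the azimuth.\<close>

lemma center_periodic: "center j (k mod int (y j)) = center j k"
proof (cases "y j = 0")
  case False
  define m where "m = k div int (y j)"
  have "k = k mod int (y j) + m * int (y j)"
    by (simp add: m_def)
  then have "real_of_int k = of_int (k mod int (y j)) + of_int m * real (y j)"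
    by (metis of_int_add of_int_mult of_int_of_nat_eq)
  then have "t j + (2 * of_int k + 1) * pi / real (y j)
      = t j + (2 * of_int (k mod int (y j)) + 1) * pi / real (y j) + 2 * pi * of_int m"
    using False by (simp add: field_simps)
  then show ?thesis
    by (simp only: center_def spherical_periodic)
qed simp

lemma center_in_config:
  assumes "j \<in> {1..n + 2}"
  shows "center j k \<in> config"
proof -
  have "(j, k mod int (y j)) \<in> index"
    using assms y_pos[OF assms] by (simp add: index_def)
  then show ?thesis
    unfolding config_def by (intro image_eqI[of _ _ "(j, k mod int (y j))"]) (simp_all add: center_periodic)
qed

lemma config_subset: "config \<subseteq> S2"
  by (auto simp: config_def center_def)

section \<open>Separation of the centers\<close>

text \<open>Centers in different collars differ in colatitude by at least \<open>h\<close>, which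
  gives the first term. In one collar the chord is at least
  \<open>2 * sin (mid j) * (2 / y j)\<close>, while \<open>sin_mid\<close> forces
  \<open>sin (mid j) \<ge> 2 * y j / (N * H)\<close>; the product is the second term.\<close>

lemma norm_center_diff_ge:
  assumes p: "(i, k) \<in> index" and q: "(j, l) \<in> index" and ne: "(i, k) \<noteq> (j, l)"
    and h: "0 < h" "\<And>j. j \<in> {1..n + 2} \<Longrightarrow> h \<le> gap j"
    and H: "\<And>j. j \<in> {1..n + 2} \<Longrightarrow> gap j \<le> H"
  shows "min (2 / pi * h) (8 / (real N * H)) \<le> norm (center i k - center j l)"
proof -
  have i: "i \<in> {1..n + 2}" and j: "j \<in> {1..n + 2}"
    and k: "0 \<le> k" "k < int (y i)" and l: "0 \<le> l" "l < int (y j)"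
    using p q by (auto simp: index_def)
  show ?thesis
  proof (cases "i = j")
    case False
    then have "h \<le> \<bar>mid i - mid j\<bar>"
      using mid_diff_ge[OF i j _ h(2)] mid_diff_ge[OF j i _ h(2)]
      by (cases "i < j") force+
    then have "2 / pi * h \<le> 2 / pi * \<bar>mid i - mid j\<bar>"
      by (intro mult_left_mono) auto
    also have "\<dots> \<le> norm (center i k - center j l)"
      unfolding center_def using mid_range i j by (intro norm_spherical_diff_ge_colatitude) auto
    finally show ?thesis by simp
  next
    case True
    have kl: "k \<noteq> l" using ne True by simp
    \<comment> \<open>A cap has only one cell, so two distinct centers in the same collar make it an
      inner one.\<close>
    have inner: "2 \<le> j" "j \<le> n + 1"
      using j k l kl True y_caps by (cases "j = 1"; cases "j = n + 2"; force)+
    have gap: "0 < gap j" "gap j \<le> H"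
      using gap_pos[OF j] H[OF j] by auto
    define d where "d = \<bar>k - l\<bar>"
    have d: "1 \<le> d" "d + 1 \<le> int (y j)"
      using k l kl True by (auto simp: d_def)
    have d': "1 \<le> real_of_int d" "real_of_int d + 1 \<le> real (y j)"
      using d by linarith+
    \<comment> \<open>Half the azimuth difference. It lies between \<open>pi / y j\<close> and
      \<open>pi - pi / y j\<close>, and Jordan's inequality, applied to \<open>\<beta>\<close> or to
      its reflection \<open>pi - \<beta>\<close>, bounds its sine below by
      \<open>2 / y j\<close>.\<close>
    define \<beta> where "\<beta> = pi * of_int d / real (y j)"
    have "\<bar>sin (((t j + (2 * of_int k + 1) * pi / real (y j))
        - (t j + (2 * of_int l + 1) * pi / real (y j))) / 2)\<bar> = \<bar>sin \<beta>\<bar>"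
    proof -
      have "((t j + (2 * of_int k + 1) * pi / real (y j))
        - (t j + (2 * of_int l + 1) * pi / real (y j))) / 2 = pi * of_int (k - l) / real (y j)"
        using d' by (simp add: field_simps)
      moreover have "k - l = d \<or> k - l = - d"
        by (auto simp: d_def)
      ultimately show ?thesis
        by (elim disjE) (simp_all only: \<beta>_def of_int_minus mult_minus_right sin_minus
            abs_minus_cancel flip: minus_divide_left)
    qed
    then have nrm: "norm (center i k - center j l) = 2 * sin (mid j) * \<bar>sin \<beta>\<bar>"
      using mid_range[OF j] True unfolding center_def by (simp add: norm_spherical_diff_same_colatitude)
    have sin\<beta>: "2 / real (y j) \<le> sin \<beta>"
    proof (cases "\<beta> \<le> pi / 2")
      case True
      have "2 / real (y j) \<le> 2 / pi * \<beta>"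
        using d' by (simp add: \<beta>_def field_simps)
      then show ?thesis
        using two_over_pi_le_sin[of \<beta>] True d' by (simp add: \<beta>_def)
    next
      case False
      have eq: "2 / pi * (pi - \<beta>) = 2 * (real (y j) - of_int d) / real (y j)"
        using d' by (simp add: \<beta>_def divide_simps) (simp add: algebra_simps)
      have "2 / real (y j) \<le> 2 / pi * (pi - \<beta>)"
        unfolding eq using d' by (intro divide_right_mono) auto
      moreover from this have "0 \<le> 2 / pi * (pi - \<beta>)"
        by (rule order_trans[rotated]) simp
      then have "0 \<le> pi - \<beta>"
        using pi_gt_zero by (auto simp: zero_le_divide_iff not_le simp del: pi_gt_zero)
      ultimately show ?thesis
        using two_over_pi_le_sin[of "pi - \<beta>"] False by simp
    qed
    have "sin (gap j / 2) \<le> H / 2"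
      using sin_x_le_x[of "gap j / 2"] gap by simp
    then have "sin (mid j) * sin (gap j / 2) \<le> sin (mid j) * (H / 2)"
      using mid_range[OF j] by (intro mult_left_mono sin_ge_zero)
    then have "real (y j) / real N \<le> sin (mid j) * (H / 2)"
      by (simp only: sin_mid[OF inner])
    then have "8 / (real N * H) \<le> 2 * sin (mid j) * (2 / real (y j))"
      using gap N_pos d' by (simp add: field_simps)
    also have "\<dots> \<le> 2 * sin (mid j) * \<bar>sin \<beta>\<bar>"
      using mid_range[OF j] sin\<beta> by (intro mult_left_mono mult_nonneg_nonneg sin_ge_zero) auto
    finally show ?thesis by (simp add: nrm)
  qed
qed

text \<open>The separation bound with the smallest gap as \<open>h\<close> and with
  \<open>H = pi\<close> is positive, so distinct indices have distinct centers.\<close>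

lemma inj_on_center: "inj_on (\<lambda>(j, k). center j k) index"
proof (rule inj_onI, clarify)
  fix i k j l
  assume *: "(i, k) \<in> index" "(j, l) \<in> index" "center i k = center j l"
  define h where "h = Min (gap ` {1..n + 2})"
  have h: "0 < h" "\<And>j. j \<in> {1..n + 2} \<Longrightarrow> h \<le> gap j"
    unfolding h_def using gap_pos by (subst Min_gr_iff) auto
  have H: "gap j \<le> pi" if "j \<in> {1..n + 2}" for j
    using that by (rule gap_le_pi)
  show "i = j \<and> k = l"
  proof (rule ccontr)
    assume "\<not> ?thesis"
    then have "min (2 / pi * h) (8 / (real N * pi)) \<le> norm (center i k - center j l)"
      using * h H by (intro norm_center_diff_ge) auto
    moreover have "0 < min (2 / pi * h) (8 / (real N * pi))"
      using h N_pos by simp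
    ultimately show False using *(3) by (simp only: diff_self norm_zero)
  qed
qed

lemma card_config: "card config = N"
  by (simp add: config_def card_image inj_on_center card_index)

lemma finite_config: "finite config"
  by (simp add: config_def finite_index)

lemma sum_config: "sum f config = (\<Sum>(j, k)\<in>index. f (center j k))"
  unfolding config_def by (subst sum.reindex[OF inj_on_center]) (simp add: case_prod_unfold)

section \<open>Covering by the centers\<close>

text \<open>The tolerance of three half widths, instead of one, lets the same bound serve tiles
  whose azimuths are not aligned with the cells.\<close>

lemma norm_diff_center_le:
  assumes j: "j \<in> {1..n + 2}" and \<phi>: "\<Phi> (j - 1) \<le> \<phi>" "\<phi> \<le> \<Phi> j"
    and \<theta>: "\<bar>\<theta> - (t j + (2 * of_int k + 1) * pi / real (y j))\<bar> \<le> 3 * (pi / real (y j))"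
    and h: "0 < h" "h \<le> gap j" and H: "gap j \<le> H"
  shows "norm (spherical \<phi> \<theta> - center j k) \<le> H + 3 * (pi\<^sup>2 / (real N * h))"
proof -
  have "norm (spherical \<phi> \<theta> - center j k)
      \<le> \<bar>\<phi> - mid j\<bar> + sin (mid j) * \<bar>\<theta> - (t j + (2 * of_int k + 1) * pi / real (y j))\<bar>"
    unfolding center_def by (intro norm_spherical_diff_le mid_range j)
  also have "\<dots> \<le> \<bar>\<phi> - mid j\<bar> + sin (mid j) * (3 * (pi / real (y j)))"
    using mid_range[OF j] \<theta> by (intro add_left_mono mult_left_mono sin_ge_zero)
  also have "\<bar>\<phi> - mid j\<bar> \<le> H"
    using mid_bounds[OF j] \<phi> H by (auto simp: gap_def)
  finally have "norm (spherical \<phi> \<theta> - center j k) \<le> H + 3 * (sin (mid j) * (pi / real (y j)))"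
    by (simp only: mult.left_commute)
  then show ?thesis
    using sin_mid_le[OF j h] by linarith
qed

lemma ex_collar:
  assumes "0 \<le> \<phi>" "\<phi> \<le> pi"
  obtains j where "j \<in> {1..n + 2}" "\<Phi> (j - 1) \<le> \<phi>" "\<phi> \<le> \<Phi> j"
proof (cases "\<phi> = 0")
  \<comment> \<open>The search for the least boundary not below \<open>\<phi>\<close> would stop at
    index 0 here, which is not a collar.\<close>
  case True
  then show ?thesis using that[of 1] \<Phi>_first \<Phi>_range[of 1] by simp
next
  case False
  define j where "j = (LEAST j. \<phi> \<le> \<Phi> j)"
  have j: "\<phi> \<le> \<Phi> j" "j \<le> n + 2"
    unfolding j_def using assms \<Phi>_last
    by (metis (lifting) LeastI, metis (lifting) Least_le)
  have "j \<noteq> 0" using j \<Phi>_first assms False by (intro notI) simp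
  then have "\<not> \<phi> \<le> \<Phi> (j - 1)"
    unfolding j_def by (intro not_less_Least) simp
  with j \<open>j \<noteq> 0\<close> show ?thesis by (intro that[of j]) auto
qed

lemma ex_near_center:
  assumes x: "x \<in> S2"
    and h: "0 < h" "\<And>j. j \<in> {1..n + 2} \<Longrightarrow> h \<le> gap j"
    and H: "\<And>j. j \<in> {1..n + 2} \<Longrightarrow> gap j \<le> H"
  shows "\<exists>c\<in>config. norm (c - x) \<le> H + 3 * (pi\<^sup>2 / (real N * h))"
proof -
  obtain \<phi> \<theta> where \<phi>: "0 \<le> \<phi>" "\<phi> \<le> pi" and x_eq: "x = spherical \<phi> \<theta>"
    using sphere_eq_spherical[OF x] .
  obtain j where j: "j \<in> {1..n + 2}" "\<Phi> (j - 1) \<le> \<phi>" "\<phi> \<le> \<Phi> j"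
    using ex_collar[OF \<phi>] .
  \<comment> \<open>The azimuth of \<open>x\<close> relative to the starting angle, in units of the
    cell width; its floor is, modulo \<open>y j\<close>, the number of a cell containing
    \<open>x\<close>.\<close>
  define z where "z = (\<theta> - t j) * real (y j) / (2 * pi)"
  define k where "k = \<lfloor>z\<rfloor>"
  have y: "real (y j) > 0" using y_pos j by simp
  have "\<theta> - (t j + (2 * of_int k + 1) * pi / real (y j)) = (2 * (z - of_int k) - 1) * (pi / real (y j))"
    using y by (simp add: z_def field_simps)
  moreover have "of_int k \<le> z" "z < of_int k + 1"
    by (simp_all add: k_def)
  then have "\<bar>2 * (z - of_int k) - 1\<bar> \<le> 3"
    by simp
  ultimately have "\<bar>\<theta> - (t j + (2 * of_int k + 1) * pi / real (y j))\<bar> \<le> 3 * (pi / real (y j))"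
    using y by (simp only: abs_mult) (intro mult_mono, auto)
  then have "norm (x - center j k) \<le> H + 3 * (pi\<^sup>2 / (real N * h))"
    unfolding x_eq using j h H by (intro norm_diff_center_le) auto
  then show ?thesis
    using center_in_config[OF j(1)] by (metis norm_minus_commute)
qed

text \<open>With this shift, center number \<open>k - shift j\<close> is close to the azimuths in
  \<open>[2\<pi>k/y, 2\<pi>(k+1)/y)\<close>, whatever the starting angle.\<close>

definition shift :: "nat \<Rightarrow> int" where
  "shift j = \<lfloor>t j * real (y j) / (2 * pi)\<rfloor>"

section \<open>Tiles of equal measure and approximation of integrals\<close>

text \<open>A cell may run past azimuth \<open>2 * pi\<close>. The tiles start at azimuth 0 instead
  and are thus plain rectangles in the parameter domain, half-open to be disjoint.\<close>

definition tile :: "nat \<Rightarrow> int \<Rightarrow> (real \<times> real) set" where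
  "tile j k = {\<Phi> (j - 1)<..\<Phi> j} \<times> {2 * pi * of_int k / real (y j)..<2 * pi * (of_int k + 1) / real (y j)}"

text \<open>A translation permutes the residues modulo \<open>y j\<close>, and \<open>center\<close>
  depends on the residue only.\<close>

lemma sum_center_shift:
  fixes f :: "real ^ 3 \<Rightarrow> real"
  shows "(\<Sum>k\<in>{0..<int (y j)}. f (center j (k - shift j))) = (\<Sum>k\<in>{0..<int (y j)}. f (center j k))"
proof (rule sum.reindex_bij_witness[where i = "\<lambda>k. (k + shift j) mod int (y j)"
      and j = "\<lambda>k. (k - shift j) mod int (y j)"])
  fix k assume k: "k \<in> {0..<int (y j)}"
  show "((k - shift j) mod int (y j) + shift j) mod int (y j) = k"
    using k by (simp add: mod_add_left_eq)
  show "((k + shift j) mod int (y j) - shift j) mod int (y j) = k"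
    using k by (simp add: mod_diff_left_eq)
qed (auto simp: center_periodic)

lemma norm_tile_center_le:
  assumes "(j, k) \<in> index" "(\<phi>, \<theta>) \<in> tile j k"
    and h: "0 < h" "\<And>j. j \<in> {1..n + 2} \<Longrightarrow> h \<le> gap j"
    and H: "\<And>j. j \<in> {1..n + 2} \<Longrightarrow> gap j \<le> H"
  shows "norm (spherical \<phi> \<theta> - center j (k - shift j)) \<le> H + 3 * (pi\<^sup>2 / (real N * h))"
proof -
  have j: "j \<in> {1..n + 2}" using assms by (auto simp: index_def)
  have y: "real (y j) > 0" using y_pos j by simp
  \<comment> \<open>In units of the cell width, \<open>z\<close> is the starting angle and
    \<open>w\<close> below is the azimuth of the point. Both \<open>w - k\<close> and
    \<open>z - shift j\<close> lie between 0 and 1, so twice their difference minus 1 lies between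
    -3 and 1; hence the tolerance of three half widths.\<close>
  define z where "z = t j * real (y j) / (2 * pi)"
  have z: "of_int (shift j) \<le> z" "z < of_int (shift j) + 1"
    by (simp_all add: z_def shift_def)
  define w where "w = \<theta> * real (y j) / (2 * pi)"
  have "\<theta> - (t j + (2 * of_int (k - shift j) + 1) * pi / real (y j))
      = (2 * (w - of_int k) - 2 * (z - of_int (shift j)) - 1) * (pi / real (y j))"
    using y by (simp add: z_def w_def field_simps)
  moreover have "of_int k \<le> w" "w \<le> of_int k + 1"
    using assms(2) y by (auto simp: tile_def w_def field_simps)
  then have "\<bar>2 * (w - of_int k) - 2 * (z - of_int (shift j)) - 1\<bar> \<le> 3"
    using z by simp
  ultimately have "\<bar>\<theta> - (t j + (2 * of_int (k - shift j) + 1) * pi / real (y j))\<bar> \<le> 3 * (pi / real (y j))"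
    using y by (simp only: abs_mult) (intro mult_mono, auto)
  then show ?thesis
    using assms j by (intro norm_diff_center_le) (auto simp: tile_def)
qed

text \<open>The collar has measure \<open>y j / N\<close> and is cut into \<open>y j\<close> tiles
  of equal azimuth range.\<close>

lemma measure_tile:
  assumes "(j, k) \<in> index"
  shows "measure polar_measure (tile j k) = 1 / real N"
proof -
  have j: "j \<in> {1..n + 2}" and k: "0 \<le> k" "k + 1 \<le> int (y j)"
    using assms by (auto simp: index_def)
  have y: "real (y j) > 0" using y_pos j by simp
  have k': "0 \<le> real_of_int k" "real_of_int k + 1 \<le> real (y j)"
    using k by linarith+
  have "2 * pi * (of_int k + 1) \<le> 2 * pi * real (y j)"
    using k' by (intro mult_left_mono) auto
  then have "2 * pi * (of_int k + 1) / real (y j) \<le> 2 * pi"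
    using y by (simp only: pos_divide_le_eq)
  then have "emeasure polar_measure (tile j k) = ennreal ((cos (\<Phi> (j - 1)) - cos (\<Phi> j))
      * (2 * pi * (of_int k + 1) / real (y j) - 2 * pi * of_int k / real (y j)) / (4 * pi))"
    unfolding tile_def
    using k' y gap_pos[OF j] \<Phi>_range'[OF j]
    by (intro emeasure_polar_rectangle) (auto simp: gap_def divide_right_mono)
  also have "\<dots> = ennreal (1 / real N)"
    using y N_pos by (intro arg_cong[where f = ennreal], subst area[OF j]) (simp add: field_simps)
  finally show ?thesis by (simp add: measure_def)
qed

lemma disjoint_tiles: "disjoint_family_on (\<lambda>(j, k). tile j k) index"
proof -
  have "(j, k) = (i, l)"
    if "(j, k) \<in> index" "(i, l) \<in> index" "(\<phi>, \<theta>) \<in> tile j k" "(\<phi>, \<theta>) \<in> tile i l"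
    for i j k l \<phi> \<theta>
  proof -
    have i: "i \<in> {1..n + 2}" and j: "j \<in> {1..n + 2}"
      using that by (auto simp: index_def)
    have \<phi>: "\<Phi> (j - 1) < \<phi>" "\<phi> \<le> \<Phi> j" "\<Phi> (i - 1) < \<phi>" "\<phi> \<le> \<Phi> i"
      using that by (auto simp: tile_def)
    have "\<not> i < j" using \<phi> \<Phi>_mono[of i "j - 1"] j by fastforce
    moreover have "\<not> j < i" using \<phi> \<Phi>_mono[of j "i - 1"] i by fastforce
    ultimately have ij: "i = j" by simp
    have y: "real (y j) > 0" using y_pos j by simp
    define w where "w = \<theta> * real (y j) / (2 * pi)"
    have "of_int k \<le> w" "w < of_int k + 1" "of_int l \<le> w" "w < of_int l + 1"
      using that y unfolding ij by (auto simp: tile_def w_def field_simps)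
    then have "k = l" by linarith
    with ij show ?thesis by simp
  qed
  then show ?thesis
    unfolding disjoint_family_on_def by fast
qed

text \<open>The tiles serve as the partition, with the value of \<open>f\<close> at the shifted
  center as the value on a tile. Summing over a whole collar removes the shift.\<close>

lemma integral_approx:
  assumes f: "continuous_on S2 f"
    and h: "0 < h" "\<And>j. j \<in> {1..n + 2} \<Longrightarrow> h \<le> gap j"
    and H: "\<And>j. j \<in> {1..n + 2} \<Longrightarrow> gap j \<le> H"
    and osc: "\<And>x c. x \<in> S2 \<Longrightarrow> c \<in> S2 \<Longrightarrow> norm (x - c) \<le> H + 3 * (pi\<^sup>2 / (real N * h))
      \<Longrightarrow> \<bar>f x - f c\<bar> \<le> \<epsilon>"
  shows "\<bar>integral\<^sup>L sphere_measure f - sum f config / real N\<bar> \<le> \<epsilon>"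
proof -
  let ?S = "\<lambda>(\<phi>, \<theta>). spherical \<phi> \<theta>"
  have f_meas: "f \<in> borel_measurable (restrict_space borel S2)"
    by (rule borel_measurable_continuous_on_restrict[OF f])
  have S_meas: "?S \<in> measurable polar_measure (restrict_space borel S2)"
    by simp
  \<comment> \<open>The total mass is inherited from the image measure
    \<open>sphere_measure\<close>.\<close>
  have prob: "prob_space polar_measure"
    by (rule prob_space_distrD[OF S_meas])
       (use prob_space_sphere_measure in \<open>simp only: sphere_measure_eq_distr\<close>)
  interpret prob_space polar_measure by (rule prob)
  obtain B where B: "\<And>x. x \<in> S2 \<Longrightarrow> norm (f x) \<le> B"
    using compact_imp_bounded[OF compact_continuous_image[OF f compact_sphere]]
    by (fastforce simp: bounded_iff)
  have int: "integrable polar_measure (\<lambda>p. f (?S p))"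
    using measurable_compose[OF S_meas f_meas] B
    by (intro integrable_const_bound[of _ B]) (auto simp: case_prod_unfold)
  have eq: "integral\<^sup>L sphere_measure f = expectation (\<lambda>p. f (?S p))"
    unfolding sphere_measure_eq_distr by (rule integral_distr[OF S_meas f_meas])
  have "\<bar>expectation (\<lambda>p. f (?S p))
      - (\<Sum>i\<in>index. case i of (j, k) \<Rightarrow> f (center j (k - shift j))) / real (card index)\<bar> \<le> \<epsilon>"
  proof (rule expectation_partition_approx[where Q = "\<lambda>(j, k). tile j k"])
    show "index \<noteq> {}" using card_index N_pos by auto
    show "(case i of (j, k) \<Rightarrow> tile j k) \<in> events" for i
      by (cases i) (simp add: tile_def sets_polar_measure borel_prod[symmetric])
    show "prob (case i of (j, k) \<Rightarrow> tile j k) = 1 / real (card index)" if "i \<in> index" for i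
      using that measure_tile card_index by (cases i) simp
    show "\<bar>f (?S x) - (case i of (j, k) \<Rightarrow> f (center j (k - shift j)))\<bar> \<le> \<epsilon>"
      if "i \<in> index" "x \<in> (case i of (j, k) \<Rightarrow> tile j k)" for i x
    proof -
      obtain j k where i: "i = (j, k)" by fastforce
      obtain \<phi> \<theta> where x: "x = (\<phi>, \<theta>)" by fastforce
      have "norm (spherical \<phi> \<theta> - center j (k - shift j)) \<le> H + 3 * (pi\<^sup>2 / (real N * h))"
        using that h H unfolding i x by (intro norm_tile_center_le) auto
      then have "\<bar>f (spherical \<phi> \<theta>) - f (center j (k - shift j))\<bar> \<le> \<epsilon>"
        by (intro osc) (auto simp: center_def)
      then show ?thesis by (simp add: i x)
    qed
  qed (use finite_index disjoint_tiles int in auto)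
  also have "(\<Sum>i\<in>index. case i of (j, k) \<Rightarrow> f (center j (k - shift j)))
      = (\<Sum>j = 1..n + 2. \<Sum>k\<in>{0..<int (y j)}. f (center j (k - shift j)))"
    unfolding index_def by (subst sum.Sigma) auto
  also have "\<dots> = (\<Sum>j = 1..n + 2. \<Sum>k\<in>{0..<int (y j)}. f (center j k))"
    by (simp only: sum_center_shift)
  also have "\<dots> = sum f config"
    unfolding sum_config index_def by (subst sum.Sigma) auto
  finally show ?thesis
    by (simp only: eq card_index)
qed

end

subsection \<open>The collars of the zonal partition\<close>

text \<open>The boundaries before rounding, which cut the zone between the caps into collars of
  equal height. Meaningful for indices from 1 to \<open>num_collars N + 1\<close>.\<close>

definition ideal_colatitude :: "nat \<Rightarrow> nat \<Rightarrow> real" where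
  "ideal_colatitude N j = cap_angle N + (real j - 1) * fitting_collar_angle N"

definition cumulative :: "nat \<Rightarrow> nat \<Rightarrow> int" where
  "cumulative N j = (\<Sum>k = 1..j. num_cells N k)"

text \<open>The south polar cap has index \<open>num_collars N + 2\<close>, where \<open>num_cells\<close> is meaningless.\<close>

definition collar_size :: "nat \<Rightarrow> nat \<Rightarrow> nat" where
  "collar_size N j = (if j = num_collars N + 2 then 1 else nat (num_cells N j))"

text \<open>Sine increases up to \<open>pi / 2\<close> and is symmetric about it.\<close>

lemma sin_ge_sin_endpoint:
  fixes x :: real
  assumes "0 \<le> a" "a \<le> x" "x \<le> pi - a"
  shows "sin a \<le> sin x"
proof (cases "x \<le> pi / 2")
  case True
  then show ?thesis using assms by (intro sin_monotone_2pi_le) auto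
next
  case False
  then have "sin a \<le> sin (pi - x)"
    using assms by (intro sin_monotone_2pi_le) auto
  then show ?thesis by simp
qed

lemma cos_ge_half:
  fixes x :: real
  assumes "0 \<le> x" "x \<le> pi / 3"
  shows "1 / 2 \<le> cos x"
  using cos_monotone_0_pi_le[of x "pi / 3"] assms by (simp add: cos_60)

lemma pi_less_16_fifths: "pi < 16 / 5"
  using pi_approx by simp

section \<open>Rounding and its discrepancy\<close>

lemma num_cells_1: "num_cells N 1 = 1"
  by (simp add: num_cells.simps)

text \<open>The separate value 0 at index 1 agrees with the general sum, since ideal and actual
  count of the north cap are both 1.\<close>

lemma discrepancy_eq: "j \<ge> 1 \<Longrightarrow> discrepancy N j = (\<Sum>k = 1..j. ideal_num_cells N k) - of_int (cumulative N j)"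
  by (cases "j = 1")
     (simp_all add: discrepancy.simps[of N j] discrepancy.simps[of N "Suc 0"] sum_subtractf
       cumulative_def num_cells_1[simplified] ideal_num_cells_def)

lemma num_cells_Suc:
  "j \<ge> 1 \<Longrightarrow> num_cells N (Suc j) = round (ideal_num_cells N (Suc j) + discrepancy N j)"
  by (simp add: num_cells.simps)

text \<open>The previous discrepancy is added before rounding, so the new one is the error of a
  single rounding; errors do not accumulate.\<close>

lemma abs_discrepancy_le:
  assumes "j \<ge> 1"
  shows "\<bar>discrepancy N j\<bar> \<le> 1 / 2"
  using assms
proof (induction j rule: nat_induct_at_least)
  case base
  then show ?case by (simp add: discrepancy.simps)
next
  case (Suc j)
  then have "discrepancy N (Suc j)
      = (ideal_num_cells N (Suc j) + discrepancy N j) - of_int (num_cells N (Suc j))"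
    by (simp add: discrepancy_eq cumulative_def)
  then show ?case
    using of_int_round_abs_le[of "ideal_num_cells N (Suc j) + discrepancy N j"] Suc
    by (simp add: num_cells_Suc abs_minus_commute)
qed

section \<open>Ideal boundaries and cumulative cell counts\<close>

context
  fixes N :: nat
  assumes N: "N \<ge> 2"
begin

lemma cap_angle_bounds: "0 < cap_angle N" "cap_angle N \<le> pi / 2"
proof -
  show "0 < cap_angle N"
    unfolding cap_angle_def using N arccos_less_arccos[of "1 - 2 / real N" 1] by (simp add: field_simps)
  show "cap_angle N \<le> pi / 2"
    unfolding cap_angle_def using N arccos_le_arccos[of 0 "1 - 2 / real N"] by (simp add: field_simps)
qed

lemma cos_cap_angle: "cos (cap_angle N) = 1 - 2 / real N"
  unfolding cap_angle_def using N by (intro cos_arccos) (auto simp: field_simps)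

lemma sin_half_cap_angle: "sin (cap_angle N / 2) = 1 / sqrt (real N)"
proof (rule power2_eq_imp_eq)
  show "(sin (cap_angle N / 2))\<^sup>2 = (1 / sqrt (real N))\<^sup>2"
    using cos_double_sin[of "cap_angle N / 2"] cos_cap_angle N by (simp add: power_divide field_simps)
  show "0 \<le> sin (cap_angle N / 2)"
    using cap_angle_bounds by (intro sin_ge_zero) auto
qed simp

lemma cap_angle_sqrt_bounds: "2 / sqrt (real N) \<le> cap_angle N" "cap_angle N \<le> pi / sqrt (real N)"
proof -
  show "2 / sqrt (real N) \<le> cap_angle N"
    using sin_x_le_x[of "cap_angle N / 2"] cap_angle_bounds sin_half_cap_angle by simp
  have "2 / pi * (cap_angle N / 2) \<le> 1 / sqrt (real N)"
    using two_over_pi_le_sin[of "cap_angle N / 2"] cap_angle_bounds sin_half_cap_angle by simp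
  then show "cap_angle N \<le> pi / sqrt (real N)"
    by (simp add: field_simps)
qed

lemma num_collars_pos: "N > 2 \<Longrightarrow> num_collars N \<ge> 1"
  by (simp add: num_collars_def)

lemma num_collars_mult_angle: "real (num_collars N) * fitting_collar_angle N = pi - 2 * cap_angle N"
proof (cases "N = 2")
  \<comment> \<open>There are no collars and the caps are hemispheres, so both sides vanish.\<close>
  case True
  then show ?thesis by (simp add: num_collars_def cap_angle_def)
next
  case False
  then show ?thesis
    using num_collars_pos N by (simp add: fitting_collar_angle_def)
qed

lemma ideal_colatitude_1: "ideal_colatitude N 1 = cap_angle N"
  by (simp add: ideal_colatitude_def)

lemma ideal_colatitude_last: "ideal_colatitude N (num_collars N + 1) = pi - cap_angle N"
  using num_collars_mult_angle by (simp add: ideal_colatitude_def)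

lemma fitting_collar_angle_nonneg: "0 \<le> fitting_collar_angle N"
  using cap_angle_bounds by (simp add: fitting_collar_angle_def)

lemma ideal_colatitude_bounds:
  assumes "1 \<le> j" "j \<le> num_collars N + 1"
  shows "cap_angle N \<le> ideal_colatitude N j" "ideal_colatitude N j \<le> pi - cap_angle N"
proof -
  show "cap_angle N \<le> ideal_colatitude N j"
    using assms fitting_collar_angle_nonneg by (simp add: ideal_colatitude_def)
  have "ideal_colatitude N j \<le> ideal_colatitude N (num_collars N + 1)"
    unfolding ideal_colatitude_def
    using assms fitting_collar_angle_nonneg by (intro add_left_mono mult_right_mono) auto
  then show "ideal_colatitude N j \<le> pi - cap_angle N"
    by (simp only: ideal_colatitude_last)
qed

lemma ideal_num_cells_Suc:
  assumes "j \<ge> 1"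
  shows "ideal_num_cells N (Suc j)
    = real N / 2 * (cos (ideal_colatitude N j) - cos (ideal_colatitude N (Suc j)))"
  using assms by (simp add: ideal_num_cells_def fitting_collar_area_def ideal_colatitude_def field_simps)

text \<open>The areas telescope; the cap angle is chosen so that the cap accounts for exactly the
  first term 1.\<close>

lemma sum_ideal_num_cells:
  assumes "j \<ge> 1"
  shows "(\<Sum>k = 1..j. ideal_num_cells N k) = real N / 2 * (1 - cos (ideal_colatitude N j))"
  using assms
proof (induction j rule: nat_induct_at_least)
  case base
  then show ?case
    unfolding ideal_colatitude_1 cos_cap_angle using N by (simp add: ideal_num_cells_def)
next
  case (Suc j)
  then have "(\<Sum>k = 1..Suc j. ideal_num_cells N k)
      = real N / 2 * (1 - cos (ideal_colatitude N j)) + ideal_num_cells N (Suc j)"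
    by simp
  also have "\<dots> = real N / 2 * ((1 - cos (ideal_colatitude N j))
      + (cos (ideal_colatitude N j) - cos (ideal_colatitude N (Suc j))))"
    using Suc.hyps by (simp only: ideal_num_cells_Suc distrib_left)
  also have "\<dots> = real N / 2 * (1 - cos (ideal_colatitude N (Suc j)))"
    by simp
  finally show ?case .
qed

lemma cumulative_approx:
  assumes "j \<ge> 1"
  shows "\<bar>real_of_int (cumulative N j) - real N / 2 * (1 - cos (ideal_colatitude N j))\<bar> \<le> 1 / 2"
  using abs_discrepancy_le[OF assms, of N] discrepancy_eq[OF assms, of N] sum_ideal_num_cells[OF assms]
  by (simp only: abs_minus_commute)

lemma ideal_cumulative_bounds:
  assumes "1 \<le> j" "j \<le> num_collars N + 1"
  shows "1 \<le> real N / 2 * (1 - cos (ideal_colatitude N j))"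
    and "1 \<le> real N / 2 * (1 + cos (ideal_colatitude N j))"
proof -
  have "cos (ideal_colatitude N j) \<le> cos (cap_angle N)"
    using ideal_colatitude_bounds[OF assms] cap_angle_bounds by (intro cos_monotone_0_pi_le) auto
  then show "1 \<le> real N / 2 * (1 - cos (ideal_colatitude N j))"
    unfolding cos_cap_angle using N by (simp add: field_simps)
  have "cos (pi - cap_angle N) \<le> cos (ideal_colatitude N j)"
    using ideal_colatitude_bounds[OF assms] cap_angle_bounds by (intro cos_monotone_0_pi_le) auto
  then show "1 \<le> real N / 2 * (1 + cos (ideal_colatitude N j))"
    unfolding cos_pi_minus cos_cap_angle using N by (simp add: field_simps)
qed

text \<open>On either side of the boundary the ideal count is at least 1, and the actual count
  deviates from it by at most \<open>1 / 2\<close>.\<close>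

lemma cumulative_bounds:
  assumes "1 \<le> j" "j \<le> num_collars N + 1"
  shows "0 < cumulative N j" "cumulative N j < int N"
proof -
  have "0 < real_of_int (cumulative N j)"
    using cumulative_approx[OF assms(1)] ideal_cumulative_bounds(1)[OF assms] by linarith
  then show "0 < cumulative N j" by simp
  have "real_of_int (cumulative N j) < real N"
    using cumulative_approx[OF assms(1)] ideal_cumulative_bounds(2)[OF assms]
    by (simp only: abs_le_iff distrib_left right_diff_distrib) linarith
  then show "cumulative N j < int N" by linarith
qed

text \<open>The ideal count at the last boundary is itself an integer, and two integers at distance
  at most \<open>1 / 2\<close> coincide. Exactly one cell remains for the south cap.\<close>

lemma cumulative_last: "cumulative N (num_collars N + 1) = int N - 1"
proof -
  have "real N / 2 * (1 - cos (ideal_colatitude N (num_collars N + 1))) = real N - 1"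
    unfolding ideal_colatitude_last cos_pi_minus cos_cap_angle using N by (simp add: field_simps)
  then have "\<bar>real_of_int (cumulative N (num_collars N + 1)) - (real N - 1)\<bar> \<le> 1 / 2"
    using cumulative_approx[of "num_collars N + 1"] by (simp only: le_add2)
  then show ?thesis by linarith
qed

section \<open>Actual boundary colatitudes\<close>

lemma cos_colatitude:
  assumes "1 \<le> j" "j \<le> num_collars N + 1"
  shows "cos (colatitude N j) = 1 - 2 / real N * of_int (cumulative N j)"
proof -
  have "0 \<le> real_of_int (cumulative N j)" "real_of_int (cumulative N j) \<le> real N"
    using cumulative_bounds[OF assms] by linarith+
  then have "-1 \<le> 1 - 2 / real N * of_int (cumulative N j)" "1 - 2 / real N * of_int (cumulative N j) \<le> 1"
    using N by (auto simp: field_simps)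
  moreover have "colatitude N j = arccos (1 - 2 / real N * of_int (cumulative N j))"
    using assms by (simp add: colatitude_def cumulative_def)
  ultimately show ?thesis by (simp only: cos_arccos)
qed

lemma colatitude_range:
  assumes "j \<le> num_collars N + 2"
  shows "0 \<le> colatitude N j \<and> colatitude N j \<le> pi"
proof (cases "1 \<le> j \<and> j \<le> num_collars N + 1")
  case True
  have "0 \<le> real_of_int (cumulative N j)" "real_of_int (cumulative N j) \<le> real N"
    using cumulative_bounds[of j] True by linarith+
  then have "-1 \<le> 1 - 2 / real N * of_int (cumulative N j)" "1 - 2 / real N * of_int (cumulative N j) \<le> 1"
    using N by (auto simp: field_simps)
  moreover have "colatitude N j = arccos (1 - 2 / real N * of_int (cumulative N j))"
    using True by (simp add: colatitude_def cumulative_def)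
  ultimately show ?thesis by (simp only: arccos_lbound arccos_ubound simp_thms)
next
  case False
  then have "j = 0 \<or> j = num_collars N + 2" using assms by auto
  then show ?thesis by (auto simp: colatitude_def)
qed

section \<open>Heights and cell counts of the ideal collars\<close>

text \<open>With at least two collars the cutoff at 1 in \<open>num_collars\<close> is inactive, so
  the number is a plain rounding.\<close>

lemma abs_num_collars_diff:
  assumes "num_collars N \<ge> 2"
  shows "\<bar>real (num_collars N) - ideal_num_collars N\<bar> \<le> 1 / 2"
proof -
  have "int (num_collars N) = round (ideal_num_collars N)"
    using assms by (auto simp: num_collars_def split: if_splits)
  then have "real (num_collars N) = of_int (round (ideal_num_collars N))"
    by (metis of_int_of_nat_eq)
  then show ?thesis
    using of_int_round_abs_le[of "ideal_num_collars N"] by simp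
qed

lemma sqrt_pi_bounds: "17 / 10 \<le> sqrt pi" "sqrt pi \<le> 9 / 5"
proof -
  show "17 / 10 \<le> sqrt pi"
    using pi_gt3 by (intro real_le_rsqrt) (simp add: power2_eq_square)
  show "sqrt pi \<le> 9 / 5"
    using pi_less_16_fifths by (intro real_le_lsqrt) (simp_all add: power2_eq_square)
qed

lemma ideal_collar_angle_eq: "ideal_collar_angle N = 2 * sqrt pi / sqrt (real N)"
  by (simp add: ideal_collar_angle_def real_sqrt_mult real_sqrt_divide)

text \<open>The rounding error \<open>1 / 2\<close> is at most a quarter of the number of collars,
  so the angle lies between \<open>3 / 4\<close> and \<open>5 / 4\<close> of the ideal one, which in
  turn lies between \<open>17 / 5\<close> and \<open>18 / 5\<close> over
  \<open>sqrt N\<close>.\<close>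

lemma fitting_collar_angle_bounds:
  assumes n: "num_collars N \<ge> 2"
  shows "5 / 2 / sqrt (real N) \<le> fitting_collar_angle N"
    and "fitting_collar_angle N \<le> 9 / 2 / sqrt (real N)"
proof -
  define \<delta> where "\<delta> = ideal_collar_angle N"
  define m where "m = real (num_collars N)"
  have m: "m \<ge> 2" using n by (simp add: m_def)
  have \<delta>: "0 < \<delta>" "17 / 5 / sqrt (real N) \<le> \<delta>" "\<delta> \<le> 18 / 5 / sqrt (real N)"
  proof -
    have "17 / 5 \<le> 2 * sqrt pi" "2 * sqrt pi \<le> 18 / 5"
      using sqrt_pi_bounds by simp_all
    then show "17 / 5 / sqrt (real N) \<le> \<delta>" "\<delta> \<le> 18 / 5 / sqrt (real N)"
      unfolding \<delta>_def ideal_collar_angle_eq by (simp_all only: divide_right_mono real_sqrt_ge_zero of_nat_0_le_iff)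
    show "0 < \<delta>" unfolding \<delta>_def ideal_collar_angle_eq using N by simp
  qed
  have W: "m * fitting_collar_angle N = ideal_num_collars N * \<delta>"
    using num_collars_mult_angle \<delta> by (simp add: m_def ideal_num_collars_def \<delta>_def)
  have a: "\<bar>m - ideal_num_collars N\<bar> \<le> 1 / 2"
    using abs_num_collars_diff[OF n] by (simp add: m_def)
  have "3 / 4 * m \<le> ideal_num_collars N" "ideal_num_collars N \<le> 5 / 4 * m"
    using a m by linarith+
  then have "3 / 4 * m * \<delta> \<le> ideal_num_collars N * \<delta>" "ideal_num_collars N * \<delta> \<le> 5 / 4 * m * \<delta>"
    using \<delta> by (auto intro: mult_right_mono)
  then have "m * (3 / 4 * \<delta>) \<le> m * fitting_collar_angle N" "m * fitting_collar_angle N \<le> m * (5 / 4 * \<delta>)"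
    unfolding W by (simp_all add: mult_ac)
  then have "3 / 4 * \<delta> \<le> fitting_collar_angle N" "fitting_collar_angle N \<le> 5 / 4 * \<delta>"
    using m by auto
  then show "5 / 2 / sqrt (real N) \<le> fitting_collar_angle N"
    and "fitting_collar_angle N \<le> 9 / 2 / sqrt (real N)"
    using \<delta> divide_right_mono[of "5 / 2" "51 / 20" "sqrt (real N)"] by auto
qed

lemma ideal_num_cells_eq_sin:
  assumes "j \<ge> 2"
  shows "ideal_num_cells N j = real N * (sin (cap_angle N + (real j - 3 / 2) * fitting_collar_angle N)
      * sin (fitting_collar_angle N / 2))"
proof -
  obtain i where i: "j = Suc i" "i \<ge> 1" using assms by (cases j) auto
  have eqs: "(ideal_colatitude N i + ideal_colatitude N (Suc i)) / 2
      = cap_angle N + (real (Suc i) - 3 / 2) * fitting_collar_angle N"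
    "(ideal_colatitude N (Suc i) - ideal_colatitude N i) / 2 = fitting_collar_angle N / 2"
    by (simp_all add: ideal_colatitude_def field_simps)
  show ?thesis
    unfolding i(1) ideal_num_cells_Suc[OF i(2)] cos_diff_cos eqs by simp
qed

text \<open>The middle circles closest to the poles are those of the first and the last inner
  collar.\<close>

lemma ideal_mid_ge:
  assumes "j \<in> {2..num_collars N + 1}"
  shows "sin (cap_angle N + fitting_collar_angle N / 2)
    \<le> sin (cap_angle N + (real j - 3 / 2) * fitting_collar_angle N)"
proof (rule sin_ge_sin_endpoint)
  have "(1 / 2) * fitting_collar_angle N \<le> (real j - 3 / 2) * fitting_collar_angle N"
    using assms fitting_collar_angle_nonneg by (intro mult_right_mono) auto
  then show "cap_angle N + fitting_collar_angle N / 2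
      \<le> cap_angle N + (real j - 3 / 2) * fitting_collar_angle N"
    by simp
  have "(real j - 3 / 2) * fitting_collar_angle N \<le> (real (num_collars N) - 1 / 2) * fitting_collar_angle N"
    using assms fitting_collar_angle_nonneg by (intro mult_right_mono) auto
  also have "\<dots> = pi - 2 * cap_angle N - fitting_collar_angle N / 2"
    unfolding num_collars_mult_angle[symmetric] by (simp add: algebra_simps)
  finally show "cap_angle N + (real j - 3 / 2) * fitting_collar_angle N
      \<le> pi - (cap_angle N + fitting_collar_angle N / 2)"
    by simp
qed (use cap_angle_bounds fitting_collar_angle_nonneg in auto)

lemma fitting_collar_angle_le:
  assumes "num_collars N \<ge> 2"
  shows "fitting_collar_angle N \<le> pi / 2 - cap_angle N"
proof -
  have "2 * fitting_collar_angle N \<le> real (num_collars N) * fitting_collar_angle N"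
    using assms fitting_collar_angle_nonneg by (intro mult_right_mono) auto
  then show ?thesis unfolding num_collars_mult_angle by simp
qed

text \<open>This keeps rounding from producing an empty collar. A single collar receives all cells
  but the two caps. Otherwise the count is smallest next to the poles, where Jordan's inequality
  bounds both sines of \<open>ideal_num_cells_eq_sin\<close> from below.\<close>

lemma ideal_num_cells_ge_1:
  assumes j: "j \<in> {2..num_collars N + 1}"
  shows "1 \<le> ideal_num_cells N j"
proof -
  have "num_collars N \<noteq> 0" using j by auto
  then have N3: "N \<ge> 3" using N by (cases "N = 2") (auto simp: num_collars_def)
  show ?thesis
  proof (cases "num_collars N = 1")
    case True
    then have "j = Suc 1" using j by auto
    have "ideal_colatitude N (Suc 1) = pi - cap_angle N"
      using ideal_colatitude_last True by simp
    then have "ideal_num_cells N j = real N / 2 * (cos (cap_angle N) - cos (pi - cap_angle N))"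
      using ideal_num_cells_Suc[of 1] by (simp only: ideal_colatitude_1 \<open>j = Suc 1\<close> order_refl)
    also have "\<dots> = real N - 2"
      unfolding cos_pi_minus cos_cap_angle using N by (simp add: field_simps)
    finally have "ideal_num_cells N j = real N - 2" .
    then show ?thesis using N3 by simp
  next
    case False
    then have n: "num_collars N \<ge> 2" using \<open>num_collars N \<noteq> 0\<close> by simp
    note \<delta> = fitting_collar_angle_bounds[OF n] fitting_collar_angle_le[OF n] fitting_collar_angle_nonneg
    let ?s = "sqrt (real N)"
    have s: "?s > 0" using N by simp
    \<comment> \<open>Here \<open>13 / 4 = 2 + 5 / 4\<close>: the cap angle plus half the collar
      height, by their lower bounds.\<close>
    have "13 / 4 / ?s \<le> cap_angle N + fitting_collar_angle N / 2"
      using cap_angle_sqrt_bounds(1) \<delta>(1) by (simp add: field_simps)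
    then have "2 / pi * (13 / 4 / ?s) \<le> 2 / pi * (cap_angle N + fitting_collar_angle N / 2)"
      by (intro mult_left_mono) auto
    also have "\<dots> \<le> sin (cap_angle N + fitting_collar_angle N / 2)"
      using \<delta> cap_angle_bounds by (intro two_over_pi_le_sin) auto
    also have "\<dots> \<le> sin (cap_angle N + (real j - 3 / 2) * fitting_collar_angle N)"
      by (rule ideal_mid_ge[OF j])
    finally have 1: "2 / pi * (13 / 4 / ?s) \<le> sin (cap_angle N + (real j - 3 / 2) * fitting_collar_angle N)" .
    have "2 / pi * (5 / 4 / ?s) \<le> 2 / pi * (fitting_collar_angle N / 2)"
      using \<delta>(1) by (intro mult_left_mono) (auto simp: field_simps)
    also have "\<dots> \<le> sin (fitting_collar_angle N / 2)"
      using \<delta> cap_angle_bounds by (intro two_over_pi_le_sin) auto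
    finally have 2: "2 / pi * (5 / 4 / ?s) \<le> sin (fitting_collar_angle N / 2)" .
    \<comment> \<open>After cancelling \<open>N\<close>, the product of the two sine bounds is at
      least 1 because four times the square of pi is below 65.\<close>
    have "pi * pi \<le> 16 / 5 * (16 / 5)"
      using pi_less_16_fifths by (intro mult_mono) auto
    then have "(pi * pi) * real N \<le> 256 / 25 * real N"
      by (intro mult_right_mono) auto
    moreover have "pi * (pi * (?s * (?s * 4))) = 4 * ((pi * pi) * (?s * ?s))"
      by (simp only: mult_ac)
    then have "pi * (pi * (?s * (?s * 4))) = 4 * ((pi * pi) * real N)"
      by simp
    ultimately have "pi * (pi * (?s * (?s * 4))) \<le> real N * 65"
      by linarith
    then have "1 \<le> real N * ((2 / pi * (13 / 4 / ?s)) * (2 / pi * (5 / 4 / ?s)))"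
      using N by (simp add: field_simps)
    also have "\<dots> \<le> real N * (sin (cap_angle N + (real j - 3 / 2) * fitting_collar_angle N)
        * sin (fitting_collar_angle N / 2))"
      using s by (intro mult_left_mono mult_mono' 1 2) auto
    finally show ?thesis
      using j by (simp add: ideal_num_cells_eq_sin)
  qed
qed

section \<open>Cell counts after rounding\<close>

text \<open>The carried discrepancy and the rounding each contribute at most \<open>1 / 2\<close>,
  so the count is off by at most 1, while the ideal count is at least 1.\<close>

lemma num_cells_bounds:
  assumes j: "j \<in> {2..num_collars N + 1}"
  shows "1 \<le> num_cells N j"
    and "ideal_num_cells N j / 2 \<le> of_int (num_cells N j)"
    and "of_int (num_cells N j) \<le> 2 * ideal_num_cells N j"
proof -
  obtain i where i: "j = Suc i" "i \<ge> 1" using j by (cases j) auto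
  define x where "x = ideal_num_cells N j + discrepancy N i"
  have y: "num_cells N j = \<lfloor>x + 1 / 2\<rfloor>"
    unfolding i(1) num_cells_Suc[OF i(2)] by (simp add: x_def i round_def)
  have x: "\<bar>x - ideal_num_cells N j\<bar> \<le> 1 / 2"
    using abs_discrepancy_le[OF i(2), of N] by (simp add: x_def)
  have ge: "1 \<le> ideal_num_cells N j" by (rule ideal_num_cells_ge_1[OF j])
  show y1: "1 \<le> num_cells N j"
  proof -
    \<comment> \<open>In the extreme case \<open>x = 1 / 2\<close> the count is 1 and not 0 because
      ties are rounded upwards.\<close>
    have "1 \<le> x + 1 / 2" using x ge unfolding abs_le_iff by linarith
    then show ?thesis unfolding y by (simp add: le_floor_iff)
  qed
  have "of_int (num_cells N j) \<le> x + 1 / 2" "x + 1 / 2 < of_int (num_cells N j) + 1"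
    unfolding y by linarith+
  moreover have "1 \<le> real_of_int (num_cells N j)" using y1 by linarith
  ultimately show "ideal_num_cells N j / 2 \<le> of_int (num_cells N j)"
    and "of_int (num_cells N j) \<le> 2 * ideal_num_cells N j"
    using x ge unfolding abs_le_iff by linarith+
qed

lemma of_nat_collar_size:
  assumes "j \<in> {1..num_collars N + 1}"
  shows "int (collar_size N j) = num_cells N j" "0 < collar_size N j"
proof -
  have "1 \<le> num_cells N j"
    using num_cells_bounds(1)[of j] assms num_cells_1[of N] by (cases "j = 1") auto
  then show "int (collar_size N j) = num_cells N j" "0 < collar_size N j"
    using assms by (auto simp: collar_size_def)
qed

section \<open>The zonal partition as a grid\<close>

lemma zonal_grid: "zonal_grid N (num_collars N) (collar_size N) (colatitude N)"
proof
  let ?n = "num_collars N"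
  show "0 < N" using N by simp
  show "colatitude N 0 = 0" "colatitude N (?n + 2) = pi"
    by (simp_all add: colatitude_def)
  show "0 \<le> colatitude N j \<and> colatitude N j \<le> pi" if "j \<le> ?n + 2" for j
    by (rule colatitude_range[OF that])
  show "collar_size N 1 = 1" "collar_size N (?n + 2) = 1"
    by (simp_all add: collar_size_def num_cells_1[simplified])
  show "0 < collar_size N j" if "j \<in> {1..?n + 2}" for j
    using that of_nat_collar_size(2)[of j] by (cases "j = ?n + 2") (auto simp: collar_size_def)
  show "cos (colatitude N (j - 1)) - cos (colatitude N j) = 2 * real (collar_size N j) / real N"
    if j: "j \<in> {1..?n + 2}" for j
  proof -
    consider "j = 1" | "j = ?n + 2" | "2 \<le> j" "j \<le> ?n + 1"
      using j by fastforce
    then show ?thesis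
    proof cases
      case 1
      then show ?thesis
        using cos_colatitude[of 1]
        by (simp add: colatitude_def[of N 0] cumulative_def num_cells_1[simplified] collar_size_def)
    next
      \<comment> \<open>By \<open>cumulative_last\<close> all cells but one lie above, so the
        remaining area is that of one cell.\<close>
      case 2
      then show ?thesis
        using cos_colatitude[of "?n + 1"] N unfolding cumulative_last
        by (simp add: colatitude_def[of N "Suc (Suc ?n)"] collar_size_def field_simps)
    next
      case 3
      then obtain i where i: "j = Suc i" "i \<ge> 1" by (cases j) auto
      have "real (collar_size N j) = of_int (num_cells N j)"
        using of_nat_collar_size(1)[of j] 3 by (metis atLeastAtMost_iff of_int_of_nat_eq one_le_numeral order_trans)
      moreover have "cumulative N j = cumulative N i + num_cells N j"
        by (simp add: i cumulative_def)
      ultimately show ?thesis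
        using 3 cos_colatitude[of j] cos_colatitude[of i] i
        by (simp add: algebra_simps add_divide_distrib)
    qed
  qed
qed

lemma cell_center_image_eq_config:
  "cell_center ` zonal_partition N \<theta> = zonal_grid.config (num_collars N) (collar_size N) (colatitude N) \<theta>"
proof -
  let ?n = "num_collars N"
  interpret G: zonal_grid N ?n "collar_size N" "colatitude N" \<theta>
    by (rule zonal_grid)
  have split: "{1..?n + 2} = {1, ?n + 2} \<union> {2..?n + 1}" by auto
  have "G.config = (\<Union>j\<in>{1..?n + 2}. G.center j ` {0..<int (collar_size N j)})"
    unfolding G.config_def G.index_def by force
  also have "\<dots> = G.center 1 ` {0..<1} \<union> G.center (?n + 2) ` {0..<1}
      \<union> (\<Union>j\<in>{2..?n + 1}. G.center j ` {0..<int (collar_size N j)})"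
    unfolding split using G.y_caps by auto
  also have "{0..<1::int} = {0}" by auto
  also have "G.center 1 ` {0} = {vector [0, 0, 1]}"
    by (simp add: G.center_def G.mid_def spherical_def)
  also have "G.center (?n + 2) ` {0} = {vector [0, 0, -1]}"
    by (simp add: G.center_def G.mid_def spherical_def)
  also have "(\<Union>j\<in>{2..?n + 1}. G.center j ` {0..<int (collar_size N j)})
      = (\<Union>j\<in>{2..?n + 1}. cell_center ` collar_cells N \<theta> j)"
  proof (intro SUP_cong refl)
    fix j assume j: "j \<in> {2..?n + 1}"
    let ?y = "real_of_int (num_cells N j)"
    have size: "int (collar_size N j) = num_cells N j" "0 < collar_size N j"
      using of_nat_collar_size[of j] j by auto
    then have y: "real (collar_size N j) = ?y" "0 < ?y"
      by (metis of_int_of_nat_eq, metis of_int_0_less_iff of_nat_0_less_iff)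
    have center: "G.center j k = cell_center (Collar_Cell (colatitude N (j - 1)) (colatitude N j)
         (\<theta> j + of_int k * (2 * pi / ?y)) (\<theta> j + (of_int k + 1) * (2 * pi / ?y)))" for k
    proof -
      \<comment> \<open>The mean of the bounding azimuths is the odd multiple of
        \<open>pi / y\<close> used in \<open>center\<close>.\<close>
      have "(\<theta> j + of_int k * (2 * pi / ?y) + (\<theta> j + (of_int k + 1) * (2 * pi / ?y))) / 2
          = \<theta> j + (2 * of_int k + 1) * pi / ?y"
        using y by (simp add: field_simps)
      moreover have "G.mid j = (colatitude N (j - 1) + colatitude N j) / 2"
        using j by (simp add: G.mid_def)
      ultimately show ?thesis
        by (simp only: G.center_def y(1) cell_center.simps)
    qed
    show "G.center j ` {0..<int (collar_size N j)} = cell_center ` collar_cells N \<theta> j"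
      unfolding size center collar_cells_def Let_def by force
  qed
  also have "{vector [0, 0, 1]} \<union> {vector [0, 0, -1]} \<union> (\<Union>j\<in>{2..?n + 1}. cell_center ` collar_cells N \<theta> j)
      = cell_center ` zonal_partition N \<theta>"
    unfolding zonal_partition_def by (simp add: image_Un image_UN insert_commute)
  finally show ?thesis by simp
qed

section \<open>Heights of the actual collars\<close>

text \<open>From 16 on, the caps leave at least \<open>pi / 2\<close> in between and the ideal angle
  is at most \<open>9 / 10\<close>, so the ideal number of collars exceeds \<open>3 / 2\<close> and
  rounds to at least 2.\<close>

lemma two_le_num_collars:
  assumes "N \<ge> 16"
  shows "2 \<le> num_collars N"
proof -
  let ?s = "sqrt (real N)"
  have s: "4 \<le> ?s" using assms by (intro real_le_rsqrt) simp
  have "pi / ?s \<le> pi / 4"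
    using s assms by (intro divide_left_mono) auto
  then have W: "pi / 2 \<le> pi - 2 * cap_angle N"
    using cap_angle_sqrt_bounds(2) by linarith
  have "ideal_collar_angle N \<le> 2 * (9 / 5) / 4"
    unfolding ideal_collar_angle_eq using s sqrt_pi_bounds by (intro frac_le) auto
  moreover have pos: "0 < ideal_collar_angle N"
    unfolding ideal_collar_angle_eq using assms by simp
  ultimately have "3 / 2 * ideal_collar_angle N < pi - 2 * cap_angle N"
    using W pi_gt3 by simp
  then have "3 / 2 < ideal_num_collars N"
    using pos by (simp add: ideal_num_collars_def field_simps)
  then have "2 \<le> round (ideal_num_collars N)"
    unfolding round_def by linarith
  then show ?thesis
    using assms by (simp add: num_collars_def)
qed

text \<open>If \<open>c\<close> cells lie above a circle, its squared sine is proportional to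
  \<open>c * (N - c)\<close>. The ideal values of both factors are at least 1 and are changed by at
  most \<open>1 / 2\<close>, so each changes by a factor of at most 2, their product by 4 and the
  sine by 2.\<close>

lemma sin_colatitude_bounds:
  assumes j: "1 \<le> j" "j \<le> num_collars N + 1"
  shows "sin (ideal_colatitude N j) / 2 \<le> sin (colatitude N j)"
    and "sin (colatitude N j) \<le> 2 * sin (ideal_colatitude N j)"
proof -
  define a where "a = real_of_int (cumulative N j)"
  define b where "b = real N / 2 * (1 - cos (ideal_colatitude N j))"
  have ab: "\<bar>a - b\<bar> \<le> 1 / 2"
    using cumulative_approx[OF j(1)] by (simp add: a_def b_def)
  have b: "1 \<le> b" "1 \<le> real N - b"
    using ideal_cumulative_bounds[OF j] unfolding b_def distrib_left right_diff_distrib by linarith+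
  have "a - b \<le> 1 / 2" "b - a \<le> 1 / 2"
    using abs_le_D1[OF ab] abs_le_D2[OF ab] by simp_all
  then have a: "b / 2 \<le> a" "a \<le> 2 * b" "(real N - b) / 2 \<le> real N - a" "real N - a \<le> 2 * (real N - b)"
    using b by (simp_all add: field_simps)
  have sin_sq: "(sin z)\<^sup>2 = 4 / (real N)\<^sup>2 * (c * (real N - c))" if "cos z = 1 - 2 / real N * c" for c z
    unfolding sin_squared_eq that using N by (simp add: power2_eq_square field_simps)
  have sa: "(sin (colatitude N j))\<^sup>2 = 4 / (real N)\<^sup>2 * (a * (real N - a))"
    using cos_colatitude[OF j] by (intro sin_sq) (simp add: a_def)
  have sb: "(sin (ideal_colatitude N j))\<^sup>2 = 4 / (real N)\<^sup>2 * (b * (real N - b))"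
    using N by (intro sin_sq) (simp add: b_def field_simps)
  have pos: "0 \<le> sin (colatitude N j)" "0 \<le> sin (ideal_colatitude N j)"
    using colatitude_range[of j] ideal_colatitude_bounds[OF j] cap_angle_bounds j
    by (auto intro!: sin_ge_zero)
  have "(b / 2) * ((real N - b) / 2) \<le> a * (real N - a)"
    using a b by (intro mult_mono) auto
  then have "4 / (real N)\<^sup>2 * ((b / 2) * ((real N - b) / 2)) \<le> 4 / (real N)\<^sup>2 * (a * (real N - a))"
    by (intro mult_left_mono) auto
  then have "(sin (ideal_colatitude N j) / 2)\<^sup>2 \<le> (sin (colatitude N j))\<^sup>2"
    unfolding sa power_divide sb by simp
  then show "sin (ideal_colatitude N j) / 2 \<le> sin (colatitude N j)"
    using pos(1) by (rule power2_le_imp_le)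
  have "a * (real N - a) \<le> (2 * b) * (2 * (real N - b))"
    using a b by (intro mult_mono) auto
  also have "\<dots> = 2\<^sup>2 * (b * (real N - b))"
    by (simp only: power2_eq_square mult_ac)
  finally have "4 / (real N)\<^sup>2 * (a * (real N - a)) \<le> 4 / (real N)\<^sup>2 * (2\<^sup>2 * (b * (real N - b)))"
    by (intro mult_left_mono) auto
  then have "(sin (colatitude N j))\<^sup>2 \<le> (2 * sin (ideal_colatitude N j))\<^sup>2"
    unfolding sa power_mult_distrib sb by (subst mult.left_commute)
  then show "sin (colatitude N j) \<le> 2 * sin (ideal_colatitude N j)"
    by (rule power2_le_imp_le) (use pos(2) in simp)
qed

text \<open>The caps are the ideal ones. For an inner collar of height \<open>g\<close> with middle
  \<open>m\<close>, the cell count controls \<open>sin m * sin (g / 2)\<close> and the boundary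
  sines control \<open>sin m * cos (g / 2)\<close>, each up to a factor 2 from the ideal collar. The
  second product compares \<open>sin m\<close> with its ideal value, after which the first compares
  the heights.\<close>

lemma gap_bounds:
  assumes n: "2 \<le> num_collars N" and j: "j \<in> {1..num_collars N + 2}"
  shows "1 / 10 / sqrt (real N) \<le> colatitude N j - colatitude N (j - 1)"
    and "colatitude N j - colatitude N (j - 1) \<le> 60 / sqrt (real N)"
proof -
  let ?n = "num_collars N" and ?s = "sqrt (real N)" and ?\<delta> = "fitting_collar_angle N"
  interpret G: zonal_grid N ?n "collar_size N" "colatitude N" "\<lambda>_. 0"
    by (rule zonal_grid)
  define g where "g = colatitude N j - colatitude N (j - 1)"
  have s: "1 \<le> ?s" using N by simp
  have cap: "1 / 10 / ?s \<le> cap_angle N \<and> cap_angle N \<le> 60 / ?s"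
    using cap_angle_sqrt_bounds pi_less_16_fifths s
      divide_right_mono[of "1 / 10" 2 ?s] divide_right_mono[of pi 60 ?s] by linarith
  consider "j = 1" | "j = ?n + 2" | "2 \<le> j" "j \<le> ?n + 1"
    using j by fastforce
  then have "1 / 10 / ?s \<le> g \<and> g \<le> 60 / ?s"
  proof cases
    case 1
    then have "g = cap_angle N"
      by (simp add: g_def colatitude_def num_cells_1[simplified] cap_angle_def)
    then show ?thesis using cap by simp
  next
    case 2
    \<comment> \<open>Since \<open>N - 1\<close> cells lie above it, this boundary mirrors that of
      the north cap.\<close>
    have "colatitude N (?n + 1) = arccos (1 - 2 / real N * of_int (cumulative N (?n + 1)))"
      by (simp add: colatitude_def cumulative_def)
    also have "1 - 2 / real N * of_int (cumulative N (?n + 1)) = - (1 - 2 / real N)"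
      unfolding cumulative_last using N by (simp add: field_simps)
    also have "arccos (- (1 - 2 / real N)) = pi - cap_angle N"
      unfolding cap_angle_def using N by (intro arccos_minus) (auto simp: field_simps)
    finally have "g = cap_angle N"
      using 2 by (simp add: g_def colatitude_def[of N "Suc (Suc ?n)"])
    then show ?thesis using cap by simp
  next
    case 3
    define m where "m = (colatitude N (j - 1) + colatitude N j) / 2"
    define \<mu> where "\<mu> = cap_angle N + (real j - 3 / 2) * ?\<delta>"
    define Y where "Y = real_of_int (num_cells N j)"
    have jj: "j \<in> {2..?n + 1}" using 3 by simp
    note \<delta> = fitting_collar_angle_bounds[OF n] fitting_collar_angle_le[OF n] fitting_collar_angle_nonneg
    have g: "0 < g" "g \<le> pi"
      using G.gap_pos[OF j] G.gap_le_pi[OF j] by (simp_all add: G.gap_def g_def)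
    have m_eq: "G.mid j = m" using 3 by (simp add: G.mid_def m_def)
    have "real (collar_size N j) = Y"
      using of_nat_collar_size(1)[of j] 3 unfolding Y_def
      by (metis atLeastAtMost_iff of_int_of_nat_eq one_le_numeral order_trans)
    then have Y: "sin m * sin (g / 2) = Y / real N"
      using G.sin_mid[of j] 3 by (simp add: m_eq G.gap_def g_def)
    have I: "ideal_num_cells N j = real N * (sin \<mu> * sin (?\<delta> / 2))"
      using ideal_num_cells_eq_sin[of j] 3 by (simp add: \<mu>_def)
    have YI: "real N * (sin \<mu> * sin (?\<delta> / 2)) / 2 \<le> Y" "Y \<le> 2 * (real N * (sin \<mu> * sin (?\<delta> / 2)))"
      using num_cells_bounds[OF jj] by (simp_all add: Y_def I)
    have sY: "sin \<mu> * sin (?\<delta> / 2) / 2 \<le> sin m * sin (g / 2)"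
      "sin m * sin (g / 2) \<le> 2 * (sin \<mu> * sin (?\<delta> / 2))"
      unfolding Y using YI N by (simp_all add: field_simps)
    have "0 < sin \<mu> * sin (?\<delta> / 2)"
    proof (rule zero_less_mult_pos)
      show "0 < real N * (sin \<mu> * sin (?\<delta> / 2))"
        using ideal_num_cells_ge_1[OF jj] unfolding I by linarith
    qed (use N in simp)
    moreover have sin\<delta>: "0 < sin (?\<delta> / 2)"
    proof -
      have "0 < 5 / 2 / ?s" using N by simp
      then have "0 < ?\<delta>" using \<delta>(1) by linarith
      then show ?thesis using \<delta>(3) cap_angle_bounds by (intro sin_gt_zero) auto
    qed
    ultimately have \<mu>: "0 < sin \<mu>" by (simp add: zero_less_mult_iff)
    have m: "0 \<le> sin m"
      using G.mid_range[OF j] unfolding m_eq by (intro sin_ge_zero)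
    \<comment> \<open>The mean of the boundary sines is the sine of the middle times the cosine of
      the half height; \<open>S2\<close> is the ideal counterpart.\<close>
    have S1: "sin (colatitude N (j - 1)) + sin (colatitude N j) = 2 * (sin m * cos (g / 2))"
    proof -
      have "cos ((colatitude N (j - 1) - colatitude N j) / 2) = cos (g / 2)"
        unfolding g_def by (metis cos_minus minus_diff_eq minus_divide_left)
      then show ?thesis unfolding sin_plus_sin m_def by simp
    qed
    have S2: "sin (ideal_colatitude N (j - 1)) + sin (ideal_colatitude N j) = 2 * (sin \<mu> * cos (?\<delta> / 2))"
    proof -
      have "(ideal_colatitude N (j - 1) + ideal_colatitude N j) / 2 = \<mu>"
        "(ideal_colatitude N (j - 1) - ideal_colatitude N j) / 2 = - (?\<delta> / 2)"
        using 3 by (simp_all add: ideal_colatitude_def \<mu>_def of_nat_diff field_simps)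
      then show ?thesis unfolding sin_plus_sin by simp
    qed
    have lo: "sin \<mu> * cos (?\<delta> / 2) \<le> 2 * (sin m * cos (g / 2))"
      and hi: "sin m * cos (g / 2) \<le> 2 * (sin \<mu> * cos (?\<delta> / 2))"
    proof -
      have "1 \<le> j - 1" "j - 1 \<le> ?n + 1" "1 \<le> j" "j \<le> ?n + 1"
        using 3 by auto
      note sin_colatitude_bounds[OF this(1,2)] sin_colatitude_bounds[OF this(3,4)]
      with S1 S2 show "sin \<mu> * cos (?\<delta> / 2) \<le> 2 * (sin m * cos (g / 2))"
        and "sin m * cos (g / 2) \<le> 2 * (sin \<mu> * cos (?\<delta> / 2))"
        by linarith+
    qed
    have "1 / 2 \<le> cos (?\<delta> / 2)"
      using \<delta> cap_angle_bounds by (intro cos_ge_half) auto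
    then have "sin \<mu> * (1 / 2) \<le> sin \<mu> * cos (?\<delta> / 2)"
      using \<mu> by (intro mult_left_mono) auto
    also note lo
    also have "sin m * cos (g / 2) \<le> sin m * 1"
      using m by (intro mult_left_mono) auto
    finally have m_ge: "sin \<mu> \<le> 4 * sin m" by simp
    have sg: "0 \<le> sin (g / 2)" using g by (intro sin_ge_zero) auto
    have "sin \<mu> * sin (g / 2) \<le> 4 * sin m * sin (g / 2)"
      using m_ge sg by (intro mult_right_mono)
    also have "\<dots> \<le> sin \<mu> * (8 * sin (?\<delta> / 2))"
      using sY by simp
    finally have "sin (g / 2) \<le> 8 * sin (?\<delta> / 2)"
      using \<mu> by simp
    also have "\<dots> \<le> 8 * (?\<delta> / 2)"
      using \<delta> by (intro mult_left_mono sin_x_le_x) auto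
    also have "\<dots> \<le> 18 / ?s"
      using \<delta>(2) by simp
    \<comment> \<open>With \<open>pi < 16 / 5\<close> this yields
      \<open>g \<le> 57.6 / sqrt N\<close>, rounded to 60.\<close>
    finally have "2 / pi * (g / 2) \<le> 18 / ?s"
      using two_over_pi_le_sin[of "g / 2"] g by simp
    then have "g \<le> pi * (18 / ?s)"
      by (simp add: field_simps)
    also have "\<dots> \<le> 16 / 5 * (18 / ?s)"
      using pi_less_16_fifths s by (intro mult_right_mono) auto
    also have "\<dots> \<le> 60 / ?s"
      using s by (simp add: field_simps)
    finally have upper: "g \<le> 60 / ?s" .
    have lower: "1 / 10 / ?s \<le> g"
    \<comment> \<open>Bounding \<open>sin m\<close> from above needs \<open>cos (g / 2)\<close> away
      from zero; for larger \<open>g\<close> the claim is immediate, since then \<open>g\<close>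
      exceeds 1.\<close>
    proof (cases "g / 2 \<le> pi / 3")
      case True
      then have "1 / 2 \<le> cos (g / 2)"
        using g by (intro cos_ge_half) auto
      then have "sin m * (1 / 2) \<le> sin m * cos (g / 2)"
        using m by (intro mult_left_mono)
      also note hi
      also have "sin \<mu> * cos (?\<delta> / 2) \<le> sin \<mu> * 1"
        using \<mu> by (intro mult_left_mono) auto
      finally have m_le: "sin m \<le> 4 * sin \<mu>" by simp
      have "sin \<mu> * sin (?\<delta> / 2) \<le> 2 * (sin m * sin (g / 2))"
        using sY by simp
      also have "\<dots> \<le> 2 * (4 * sin \<mu> * sin (g / 2))"
        using m_le sg by (intro mult_left_mono mult_right_mono) auto
      finally have "sin \<mu> * sin (?\<delta> / 2) \<le> sin \<mu> * (8 * sin (g / 2))"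
        by simp
      then have "sin (?\<delta> / 2) \<le> 8 * sin (g / 2)"
        using \<mu> by simp
      also have "\<dots> \<le> 8 * (g / 2)"
        using g by (intro mult_left_mono sin_x_le_x) auto
      finally have "sin (?\<delta> / 2) \<le> 4 * g" by simp
      moreover have "2 / pi * (?\<delta> / 2) \<le> sin (?\<delta> / 2)"
        using \<delta> cap_angle_bounds by (intro two_over_pi_le_sin) auto
      ultimately have "2 / pi * (?\<delta> / 2) \<le> 4 * g"
        by linarith
      then have "?\<delta> \<le> 4 * g * pi"
        by (simp add: field_simps)
      also have "\<dots> \<le> 4 * g * (16 / 5)"
        using g pi_less_16_fifths by (intro mult_left_mono) auto
      finally have "5 / 2 / ?s \<le> 64 / 5 * g"
        using \<delta>(1) by simp
      then show ?thesis using s by (simp add: field_simps)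
    next
      case False
      then have "1 \<le> g" using pi_gt3 by simp
      moreover have "1 / 10 / ?s \<le> 1"
        using s N by (intro order_trans[OF divide_left_mono[of 1 ?s "1 / 10"]]) simp_all
      ultimately show ?thesis by simp
    qed
    show ?thesis using upper lower by simp
  qed
  then show "1 / 10 / ?s \<le> colatitude N j - colatitude N (j - 1)"
    and "colatitude N j - colatitude N (j - 1) \<le> 60 / ?s"
    by (simp_all add: g_def)
qed

end

subsection \<open>Equidistribution and mesh ratio\<close>

lemma integral_normalized_counting_measure:
  assumes "finite \<omega>" "\<omega> \<subseteq> S2" "continuous_on S2 f"
  shows "integral\<^sup>L (normalized_counting_measure \<omega>) f = sum f \<omega> / real (card \<omega>)"
proof -
  have "(\<lambda>x. x) \<in> measurable (uniform_count_measure \<omega>) (restrict_space borel S2)"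
    using assms(2) by (auto simp: measurable_def space_restrict_space
        space_uniform_count_measure sets_uniform_count_measure)
  moreover have "f \<in> borel_measurable (restrict_space borel S2)"
    by (rule borel_measurable_continuous_on_restrict[OF assms(3)])
  ultimately show ?thesis
    using assms(1) unfolding normalized_counting_measure_def
    by (simp add: integral_distr integral_uniform_count_measure)
qed

lemma covering_radius_le:
  assumes "finite \<omega>" "\<And>x. x \<in> S2 \<Longrightarrow> \<exists>c\<in>\<omega>. norm (c - x) \<le> r"
  shows "covering_radius \<omega> \<le> r"
  unfolding covering_radius_def
proof (rule cSUP_least)
  show "S2 \<noteq> {}" using norm_spherical by (metis dist_0_norm empty_iff mem_sphere)
  fix x :: "real ^ 3" assume "x \<in> S2"
  then obtain c where c: "c \<in> \<omega>" "norm (c - x) \<le> r" using assms(2) by blast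
  have "Min ((\<lambda>c. norm (c - x)) ` \<omega>) \<le> norm (c - x)"
    using c assms(1) by (intro Min_le) auto
  then show "Min ((\<lambda>c. norm (c - x)) ` \<omega>) \<le> r" using c by simp
qed

text \<open>All distances on the sphere are at most 2, so the supremum is over a bounded set and
  dominates its value at any one point.\<close>

lemma covering_radius_nonneg:
  assumes \<omega>: "finite \<omega>" "\<omega> \<subseteq> S2" "\<omega> \<noteq> {}"
  shows "0 \<le> covering_radius \<omega>"
proof -
  obtain c where c: "c \<in> \<omega>" using \<omega> by blast
  have "bdd_above ((\<lambda>x. Min ((\<lambda>c. norm (c - x)) ` \<omega>)) ` S2)"
  proof (rule bdd_aboveI2)
    fix x :: "real ^ 3" assume "x \<in> S2"
    have "Min ((\<lambda>c. norm (c - x)) ` \<omega>) \<le> norm (c - x)"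
      using c \<omega> by (intro Min_le) auto
    also have "\<dots> \<le> norm c + norm x" by (rule norm_triangle_ineq4)
    also have "\<dots> \<le> 2" using c \<omega> \<open>x \<in> S2\<close> by auto
    finally show "Min ((\<lambda>c. norm (c - x)) ` \<omega>) \<le> 2" .
  qed
  moreover have "0 \<le> Min ((\<lambda>a. norm (a - c)) ` \<omega>)"
    using \<omega> by (subst Min_ge_iff) auto
  ultimately show ?thesis
    unfolding covering_radius_def using c \<omega> by (intro cSUP_upper2[of _ S2 c]) auto
qed

lemma separation_ge:
  assumes "finite \<omega>" "2 \<le> card \<omega>"
    and "\<And>x y. x \<in> \<omega> \<Longrightarrow> y \<in> \<omega> \<Longrightarrow> x \<noteq> y \<Longrightarrow> d \<le> norm (x - y)"
  shows "d \<le> separation \<omega>"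
proof -
  let ?D = "{norm (x - y) | x y. x \<in> \<omega> \<and> y \<in> \<omega> \<and> x \<noteq> y}"
  have "?D \<subseteq> (\<lambda>(x, y). norm (x - y)) ` (\<omega> \<times> \<omega>)" by auto
  then have "finite ?D" using assms(1) finite_subset by blast
  moreover have "\<not> is_singleton \<omega>" "\<omega> \<noteq> {}"
    using assms(2) by (auto simp: is_singleton_altdef)
  then have "?D \<noteq> {}"
    unfolding is_singleton_def by blast
  ultimately show ?thesis
    unfolding separation_def using assms(3) by (subst Min_ge_iff) auto
qed

section \<open>Estimates for zonal configurations\<close>

lemma zonal_configurationE:
  assumes "zonal_configuration N \<omega>" "N \<ge> 2"
  obtains \<theta> where "\<omega> = zonal_grid.config (num_collars N) (collar_size N) (colatitude N) \<theta>"
  using assms cell_center_image_eq_config unfolding zonal_configuration_def by metis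

lemma zonal_configuration_basic:
  assumes "zonal_configuration N \<omega>" "N \<ge> 2"
  shows "\<omega> \<subseteq> S2" "finite \<omega>" "card \<omega> = N"
proof -
  obtain \<theta> where \<omega>: "\<omega> = zonal_grid.config (num_collars N) (collar_size N) (colatitude N) \<theta>"
    using zonal_configurationE[OF assms] .
  interpret zonal_grid N "num_collars N" "collar_size N" "colatitude N" \<theta>
    by (rule zonal_grid[OF assms(2)])
  show "\<omega> \<subseteq> S2" "finite \<omega>" "card \<omega> = N"
    unfolding \<omega> by (rule config_subset finite_config card_config)+
qed

text \<open>The grid estimates with the heights of \<open>gap_bounds\<close>. The radius
  \<open>r\<close> is \<open>H\<close> plus three half widths, and \<open>1 / 20\<close> lies below
  both \<open>2 / (10 * pi)\<close> and \<open>8 / 60\<close> from the separation bound.\<close>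

lemma zonal_configuration_mesh:
  assumes "zonal_configuration N \<omega>" "N \<ge> 16"
  defines "r \<equiv> (60 + 30 * pi\<^sup>2) / sqrt (real N)"
  shows "covering_radius \<omega> \<le> r"
    and "1 / 20 / sqrt (real N) \<le> separation \<omega>"
    and "\<And>f \<epsilon>. continuous_on S2 f \<Longrightarrow>
      (\<And>x c. x \<in> S2 \<Longrightarrow> c \<in> S2 \<Longrightarrow> norm (x - c) \<le> r \<Longrightarrow> \<bar>f x - f c\<bar> \<le> \<epsilon>) \<Longrightarrow>
      \<bar>integral\<^sup>L sphere_measure f - sum f \<omega> / real N\<bar> \<le> \<epsilon>"
proof -
  let ?s = "sqrt (real N)"
  define h where "h = 1 / 10 / ?s"
  define H where "H = 60 / ?s"
  have N: "N \<ge> 2" using assms(2) by simp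
  have s: "?s > 0" using N by simp
  obtain \<theta> where \<omega>: "\<omega> = zonal_grid.config (num_collars N) (collar_size N) (colatitude N) \<theta>"
    using zonal_configurationE[OF assms(1) N] .
  interpret zonal_grid N "num_collars N" "collar_size N" "colatitude N" \<theta>
    by (rule zonal_grid[OF N])
  have h: "0 < h" "\<And>j. j \<in> {1..num_collars N + 2} \<Longrightarrow> h \<le> gap j"
    and H: "\<And>j. j \<in> {1..num_collars N + 2} \<Longrightarrow> gap j \<le> H"
    using gap_bounds[OF N two_le_num_collars[OF N assms(2)]] s unfolding h_def H_def gap_def by auto
  have Nh: "real N * h = ?s / 10" and NH: "real N * H = 60 * ?s"
    using s by (simp_all add: h_def H_def real_div_sqrt field_simps)
  have r: "H + 3 * (pi\<^sup>2 / (real N * h)) = r"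
    unfolding Nh unfolding H_def r_def using s by (simp add: field_simps)
  show "covering_radius \<omega> \<le> r"
    unfolding \<omega> using ex_near_center[OF _ h H, unfolded r] finite_config by (intro covering_radius_le)
  have "1 / 20 / ?s \<le> min (2 / pi * h) (8 / (real N * H))"
  proof (rule min.boundedI)
    show "1 / 20 / ?s \<le> 2 / pi * h"
      using s pi_less_16_fifths by (simp add: h_def field_simps)
    show "1 / 20 / ?s \<le> 8 / (real N * H)"
      unfolding NH using s by (simp add: field_simps)
  qed
  then have "1 / 20 / ?s \<le> norm (x - y)" if "x \<in> config" "y \<in> config" "x \<noteq> y" for x y
    using that norm_center_diff_ge[OF _ _ _ h H] unfolding config_def by fastforce
  then show "1 / 20 / ?s \<le> separation \<omega>"
    unfolding \<omega> using finite_config card_config N by (intro separation_ge) auto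
  show "\<bar>integral\<^sup>L sphere_measure f - sum f \<omega> / real N\<bar> \<le> \<epsilon>"
    if "continuous_on S2 f"
      "\<And>x c. x \<in> S2 \<Longrightarrow> c \<in> S2 \<Longrightarrow> norm (x - c) \<le> r \<Longrightarrow> \<bar>f x - f c\<bar> \<le> \<epsilon>" for f \<epsilon>
    unfolding \<omega> by (rule integral_approx[OF that(1) h H, unfolded r]) (assumption | rule that(2))+
qed

theorem proposition3:
  fixes \<omega> :: "nat \<Rightarrow> (real ^ 3) set"
  assumes "\<And>N. N \<ge> 2 \<Longrightarrow> zonal_configuration N (\<omega> N)"
  shows "equidistributed \<omega> \<and> quasi_uniform \<omega>"
proof
  note basic = zonal_configuration_basic[OF assms]
  show "equidistributed \<omega>"
    unfolding equidistributed_def weak_star_convergent_def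
  proof (intro conjI allI impI)
    fix f :: "real ^ 3 \<Rightarrow> real"
    assume f: "continuous_on S2 f"
    show "(\<lambda>N. integral\<^sup>L (normalized_counting_measure (\<omega> N)) f)
        \<longlonglongrightarrow> integral\<^sup>L sphere_measure f"
    proof (rule LIMSEQ_I)
      fix \<epsilon> :: real assume \<epsilon>: "0 < \<epsilon>"
      \<comment> \<open>Compactness gives one modulus for all cells, and the radius of
        \<open>zonal_configuration_mesh\<close> tends to 0, so it eventually drops below
        \<open>d\<close>.\<close>
      have "uniformly_continuous_on S2 f"
        using f by (intro compact_uniformly_continuous) auto
      then obtain d where d: "0 < d"
        "\<And>x c. x \<in> S2 \<Longrightarrow> c \<in> S2 \<Longrightarrow> dist c x < d \<Longrightarrow> dist (f c) (f x) < \<epsilon> / 2"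
        unfolding uniformly_continuous_on_def using \<epsilon> by (meson half_gt_zero)
      have "(\<lambda>N. (60 + 30 * pi\<^sup>2) / sqrt (real N)) \<longlonglongrightarrow> 0"
        by real_asymp
      then have "\<forall>\<^sub>F N in sequentially. (60 + 30 * pi\<^sup>2) / sqrt (real N) < d"
        using d(1) by (rule order_tendstoD)
      then have "\<forall>\<^sub>F N in sequentially.
          norm (integral\<^sup>L (normalized_counting_measure (\<omega> N)) f - integral\<^sup>L sphere_measure f) < \<epsilon>"
        using eventually_ge_at_top[of 16]
      proof eventually_elim
        case (elim N)
        have "\<bar>integral\<^sup>L sphere_measure f - sum f (\<omega> N) / real N\<bar> \<le> \<epsilon> / 2"
        proof (rule zonal_configuration_mesh(3)[OF _ elim(2) f])
          fix x c :: "real ^ 3"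
          assume *: "x \<in> S2" "c \<in> S2" "norm (x - c) \<le> (60 + 30 * pi\<^sup>2) / sqrt (real N)"
          then have "dist x c < d" using elim(1) by (simp add: dist_norm)
          with d(2)[of c x] * show "\<bar>f x - f c\<bar> \<le> \<epsilon> / 2" by (simp add: dist_real_def)
        qed (use assms elim in simp)
        moreover have "integral\<^sup>L (normalized_counting_measure (\<omega> N)) f = sum f (\<omega> N) / real N"
          using basic[of N] elim f by (simp add: integral_normalized_counting_measure)
        ultimately show ?case
          using \<epsilon> by (simp add: abs_minus_commute)
      qed
      then show "\<exists>no. \<forall>N\<ge>no. norm (integral\<^sup>L (normalized_counting_measure (\<omega> N)) f
          - integral\<^sup>L sphere_measure f) < \<epsilon>"
        by (simp add: eventually_sequentially)
    qed
  qed (use basic in auto)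
  have "\<bar>mesh_ratio (\<omega> N)\<bar> \<le> 20 * (60 + 30 * pi\<^sup>2)" if N: "N \<ge> 16" for N
  proof -
    have N2: "N \<ge> 2" using N by simp
    let ?s = "sqrt (real N)"
    have s: "?s > 0" using N by simp
    note mesh = zonal_configuration_mesh(1,2)[OF assms[OF N2] N]
    have "\<omega> N \<noteq> {}" using basic(3)[OF N2 N2] N2 by auto
    then have "0 \<le> covering_radius (\<omega> N)"
      using basic[OF N2 N2] by (intro covering_radius_nonneg)
    moreover have sep: "0 < separation (\<omega> N)"
    proof -
      have "0 < 1 / 20 / ?s" using N by simp
      then show ?thesis using mesh(2) by linarith
    qed
    ultimately have "\<bar>mesh_ratio (\<omega> N)\<bar> = covering_radius (\<omega> N) / separation (\<omega> N)"
      by (simp add: mesh_ratio_def)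
    \<comment> \<open>Both bounds are of order \<open>1 / sqrt N\<close>, so \<open>N\<close>
      cancels.\<close>
    also have "\<dots> \<le> ((60 + 30 * pi\<^sup>2) / ?s) / (1 / 20 / ?s)"
      using mesh s by (intro frac_le) auto
    also have "\<dots> = 20 * (60 + 30 * pi\<^sup>2)"
      using s by (simp add: field_simps)
    finally show ?thesis .
  qed
  then have "bounded ((\<lambda>N. mesh_ratio (\<omega> N)) ` {16..})"
    by (auto simp: bounded_iff)
  \<comment> \<open>The remaining indices contribute only finitely many values.\<close>
  moreover have "bounded ((\<lambda>N. mesh_ratio (\<omega> N)) ` {2..<16})"
    by (intro finite_imp_bounded) simp
  moreover have "{2..} = {2..<16} \<union> {16::nat..}" by auto
  ultimately have "bounded ((\<lambda>N. mesh_ratio (\<omega> N)) ` {2..})"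
    by (simp only: image_Un bounded_Un)
  then show "quasi_uniform \<omega>"
    using basic unfolding quasi_uniform_def by auto
qed

end
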